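(* Let $\mathsf{k}$ be an algebraically closed field of characteristic zero, and let $\mathcal{A}$ be any generalized Weyl algebra of degree $1$ with base ring the polynomial algebra $\mathsf{k}[h]$. Then $\mathrm{Frac}\,\mathcal{A}$ is isomorphic to either the skew field of fractions of the first Weyl algebra, the skew field of fractions of a quantum plane, or $\mathsf{k}(x,y)$.
   Context: A generalized Weyl algebra of degree $1$ with base ring $D=\mathsf{k}[h]$ is the algebra $D(a,\sigma)$, where $\sigma$ is a $\mathsf{k}$-algebra automorphism of $D$ and $0\neq a\in D$, generated over $D$ by $X^+,X^-$ with relations $X^+d=\sigma(d)X^+$, $X^-d=\sigma^{-1}(d)X^-$ for $d\in D$, $X^-X^+=a$, $X^+X^-=\sigma(a)$. $\mathrm{Frac}$ denotes the skew field of fractions of an Ore domain. The first Weyl algebra is $\mathsf{k}\langle x,y\rangle/(yx-xy-1)$; a quantum plane is $\mathsf{k}_q[x,y]=\mathsf{k}\langle x,y\rangle/(yx-qxy)$ with $q\in\mathsf{k}^\times$ a parameter. *)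

theory Defs
  imports
    "HOL-Library.Poly_Mapping"
    "HOL-Computational_Algebra.Polynomial"
    "HOL-Computational_Algebra.Fraction_Field"
    "HOL-Algebra.QuotRing"
    "HOL-Algebra.Module"
begin

text \<open>
  The ground field is a type \<open>'k\<close>. A unital associative, not necessarily commutative
  \<open>'k\<close>-algebra is a record of type \<open>('k, 'a) module\<close>, that is, a ring with carrier
  equipped with a scalar multiplication \<open>\<odot>\<close> by all elements of \<open>'k\<close>.
\<close>

definition alg_iso :: "('k, 'a) module \<Rightarrow> ('k, 'b) module \<Rightarrow> ('a \<Rightarrow> 'b) set" where
  "alg_iso A B =
    {f \<in> ring_iso A B. \<forall>c. \<forall>x \<in> carrier A. f (c \<odot>\<^bsub>A\<^esub> x) = c \<odot>\<^bsub>B\<^esub> f x}"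

definition alg_isomorphic :: "('k, 'a) module \<Rightarrow> ('k, 'b) module \<Rightarrow> bool"
    (infix "\<simeq>\<^sub>a" 60) where
  "A \<simeq>\<^sub>a B \<longleftrightarrow> alg_iso A B \<noteq> {}"

text \<open>A type of rings, with a central embedding \<open>\<iota>\<close> of the scalars, as an algebra.\<close>

definition type_alg :: "('k \<Rightarrow> 'a::ring_1) \<Rightarrow> ('k, 'a) module" where
  "type_alg \<iota> = \<lparr>carrier = UNIV, mult = (*), one = 1, zero = 0, add = (+),
                 smult = (\<lambda>c x. \<iota> c * x)\<rparr>"

lemma ring_type_alg: "ring (type_alg \<iota>)"
proof (rule ringI)
  show "abelian_group (type_alg \<iota>)"
  proof (rule abelian_groupI)
    fix x assume "x \<in> carrier (type_alg \<iota>)"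
    show "\<exists>y\<in>carrier (type_alg \<iota>). y \<oplus>\<^bsub>type_alg \<iota>\<^esub> x = \<zero>\<^bsub>type_alg \<iota>\<^esub>"
      by (rule bexI[of _ "- x"]) (simp_all add: type_alg_def)
  qed (simp_all add: type_alg_def algebra_simps)
  show "Group.monoid (type_alg \<iota>)"
    by (rule monoidI) (simp_all add: type_alg_def algebra_simps)
qed (simp_all add: type_alg_def algebra_simps)

definition poly_alg :: "('k::field, 'k poly) module" where
  "poly_alg = type_alg (\<lambda>c. [:c:])"

text \<open>The field of rational functions in two variables, as the fraction field of
  \<open>'k[x][y]\<close>.\<close>

definition ratfun2_alg :: "('k::field, 'k poly poly fract) module" where
  "ratfun2_alg = type_alg (\<lambda>c. Fract [:[:c:]:] 1)"


section \<open>Algebras given by generators and relations\<close>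

text \<open>Words form a monoid under concatenation, written additively, so that the monoid
  algebra \<open>'g word \<Rightarrow>\<^sub>0 'k\<close> with its convolution product is the free
  algebra on the generators \<open>'g\<close>.\<close>

datatype 'g word = Word (letters: "'g list")

instantiation word :: (type) monoid_add
begin

definition zero_word :: "'g word" where
  "zero_word = Word []"

definition plus_word :: "'g word \<Rightarrow> 'g word \<Rightarrow> 'g word" where
  "plus_word u v = Word (letters u @ letters v)"

instance
  by standard (simp_all add: zero_word_def plus_word_def)

end

definition scal :: "'k::field \<Rightarrow> ('g word \<Rightarrow>\<^sub>0 'k)" where
  "scal c = Poly_Mapping.single 0 c"

definition gen :: "'g \<Rightarrow> ('g word \<Rightarrow>\<^sub>0 'k::field)" where
  "gen g = Poly_Mapping.single (Word [g]) 1"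

definition free_alg :: "('k::field, 'g word \<Rightarrow>\<^sub>0 'k) module" where
  "free_alg = type_alg scal"

definition quot_alg :: "('k, 'a) module \<Rightarrow> 'a set \<Rightarrow> ('k, 'a set) module" where
  "quot_alg A I =
     \<lparr>carrier = carrier (A Quot I), mult = mult (A Quot I), one = one (A Quot I),
      zero = zero (A Quot I), add = add (A Quot I),
      smult = (\<lambda>c P. \<Union>x\<in>P. I +>\<^bsub>A\<^esub> (c \<odot>\<^bsub>A\<^esub> x))\<rparr>"

text \<open>Each \<open>r \<in> rels\<close> stands for the relation \<open>r = 0\<close>; note that \<open>Idl\<close>
  is the generated two-sided ideal.\<close>

definition presented_alg ::
    "('g word \<Rightarrow>\<^sub>0 'k::field) set \<Rightarrow> ('k, ('g word \<Rightarrow>\<^sub>0 'k) set) module" where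
  "presented_alg rels = quot_alg free_alg (Idl\<^bsub>free_alg\<^esub> rels)"


section \<open>Generalized Weyl algebras, the Weyl algebra and quantum planes\<close>

text \<open>Generating over \<open>D = 'k[h]\<close> by \<open>X\<^sup>+\<close> and \<open>X\<^sup>-\<close> amounts to
  generating over \<open>'k\<close> by \<open>h\<close>, \<open>X\<^sup>+\<close> and \<open>X\<^sup>-\<close>, where
  \<open>d \<in> D\<close> is read as the polynomial expression \<open>at_H d\<close> in the generator \<open>h\<close>.\<close>

datatype gwa_gen = Hgen | Xplus | Xminus

definition at_H :: "'k::field poly \<Rightarrow> (gwa_gen word \<Rightarrow>\<^sub>0 'k)" where
  "at_H d = (\<Sum>i\<le>degree d. scal (coeff d i) * gen Hgen ^ i)"

definition gwa ::
    "'k::field poly \<Rightarrow> ('k poly \<Rightarrow> 'k poly) \<Rightarrow> ('k, (gwa_gen word \<Rightarrow>\<^sub>0 'k) set) module" where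
  "gwa a \<sigma> = presented_alg
     ({gen Xplus * at_H d - at_H (\<sigma> d) * gen Xplus | d. True} \<union>
      {gen Xminus * at_H d - at_H (inv_into UNIV \<sigma> d) * gen Xminus | d. True} \<union>
      {gen Xminus * gen Xplus - at_H a, gen Xplus * gen Xminus - at_H (\<sigma> a)})"

datatype xy_gen = Xgen | Ygen

definition weyl_alg :: "('k::field, (xy_gen word \<Rightarrow>\<^sub>0 'k) set) module" where
  "weyl_alg = presented_alg {gen Ygen * gen Xgen - gen Xgen * gen Ygen - 1}"

definition quantum_plane :: "'k::field \<Rightarrow> ('k, (xy_gen word \<Rightarrow>\<^sub>0 'k) set) module" where
  "quantum_plane q = presented_alg {gen Ygen * gen Xgen - scal q * gen Xgen * gen Ygen}"


section \<open>The skew field of fractions of an Ore domain\<close>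

text \<open>A pair \<open>(a, s)\<close> stands for the right fraction \<open>a s\<^sup>-\<^sup>1\<close>. The construction is
  meaningful if \<open>A\<close> is a right Ore domain. Two pairs are related if they become equal after
  passing to a common denominator. For the product, \<open>s b' = b s'\<close> gives
  \<open>s\<^sup>-\<^sup>1 b = b' s'\<^sup>-\<^sup>1\<close>. The operations take the union over all
  representatives and all auxiliary elements; over an Ore domain these all yield the same class.\<close>

definition frac_pairs :: "('k, 'a) module \<Rightarrow> ('a \<times> 'a) set" where
  "frac_pairs A = carrier A \<times> (carrier A - {\<zero>\<^bsub>A\<^esub>})"

definition frac_rel :: "('k, 'a) module \<Rightarrow> (('a \<times> 'a) \<times> ('a \<times> 'a)) set" where
  "frac_rel A = {((a, s), (b, t)). (a, s) \<in> frac_pairs A \<and> (b, t) \<in> frac_pairs A \<and>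
     (\<exists>u \<in> carrier A. \<exists>v \<in> carrier A.
        s \<otimes>\<^bsub>A\<^esub> u = t \<otimes>\<^bsub>A\<^esub> v \<and> s \<otimes>\<^bsub>A\<^esub> u \<noteq> \<zero>\<^bsub>A\<^esub> \<and> a \<otimes>\<^bsub>A\<^esub> u = b \<otimes>\<^bsub>A\<^esub> v)}"

definition frac_class :: "('k, 'a) module \<Rightarrow> 'a \<Rightarrow> 'a \<Rightarrow> ('a \<times> 'a) set" where
  "frac_class A a s = frac_rel A `` {(a, s)}"

definition frac_mult ::
    "('k, 'a) module \<Rightarrow> ('a \<times> 'a) set \<Rightarrow> ('a \<times> 'a) set \<Rightarrow> ('a \<times> 'a) set" where
  "frac_mult A P Q = \<Union> {frac_class A (a \<otimes>\<^bsub>A\<^esub> b') (t \<otimes>\<^bsub>A\<^esub> s') | a s b t b' s'.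
     (a, s) \<in> P \<and> (b, t) \<in> Q \<and> b' \<in> carrier A \<and> s' \<in> carrier A - {\<zero>\<^bsub>A\<^esub>} \<and>
     s \<otimes>\<^bsub>A\<^esub> b' = b \<otimes>\<^bsub>A\<^esub> s'}"

definition frac_add ::
    "('k, 'a) module \<Rightarrow> ('a \<times> 'a) set \<Rightarrow> ('a \<times> 'a) set \<Rightarrow> ('a \<times> 'a) set" where
  "frac_add A P Q = \<Union> {frac_class A (a \<otimes>\<^bsub>A\<^esub> u \<oplus>\<^bsub>A\<^esub> b \<otimes>\<^bsub>A\<^esub> v) (s \<otimes>\<^bsub>A\<^esub> u) | a s b t u v.
     (a, s) \<in> P \<and> (b, t) \<in> Q \<and> u \<in> carrier A \<and> v \<in> carrier A \<and>
     s \<otimes>\<^bsub>A\<^esub> u = t \<otimes>\<^bsub>A\<^esub> v \<and> s \<otimes>\<^bsub>A\<^esub> u \<noteq> \<zero>\<^bsub>A\<^esub>}"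

definition Frac :: "('k, 'a) module \<Rightarrow> ('k, ('a \<times> 'a) set) module" where
  "Frac A =
     \<lparr>carrier = frac_pairs A // frac_rel A, mult = frac_mult A,
      one = frac_class A \<one>\<^bsub>A\<^esub> \<one>\<^bsub>A\<^esub>, zero = frac_class A \<zero>\<^bsub>A\<^esub> \<one>\<^bsub>A\<^esub>, add = frac_add A,
      smult = (\<lambda>c P. \<Union> {frac_class A (c \<odot>\<^bsub>A\<^esub> a) s | a s. (a, s) \<in> P})\<rparr>"

end

theory Submission
  imports Defs
begin

text \<open>
  Let \<open>\<sigma>(h) = \<alpha> h + \<beta>\<close>. Sending \<open>X\<^sup>+\<close> to \<open>x\<close> and \<open>X\<^sup>-\<close> to \<open>a x\<^sup>-\<^sup>1\<close> embeds
  the generalized Weyl algebra into the skew Laurent ring \<open>k[h][x, x\<^sup>-\<^sup>1; \<sigma>]\<close>, with an image that contains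
  \<open>k[h][x; \<sigma>]\<close>; hence both have the same skew field of fractions, which therefore depends on
  \<open>\<sigma>\<close> only and not on \<open>a\<close>. The Weyl algebra and the quantum planes are themselves generalized Weyl algebras over
  \<open>k[y x]\<close>, and \<open>\<sigma>\<close> becomes their automorphism after an affine change of the variable \<open>h\<close>:
  the Weyl algebra if \<open>\<alpha> = 1\<close> and \<open>\<beta> \<noteq> 0\<close>, the quantum plane with \<open>q = 1 / \<alpha>\<close> otherwise. The case
  \<open>\<sigma> = id\<close>, with fraction field \<open>k(x, y)\<close>, is covered by \<open>q = 1\<close>.
\<close>

section \<open>Fractions over a right Ore domain\<close>

text \<open>The two skew fields are compared through a common overring of the algebras: both
  algebras are mapped injectively into one Ore domain \<open>S\<close>, and a fraction over one
  corresponds to those fractions over the other that equal it in \<open>S\<close>. For this it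
  suffices that each element of \<open>S\<close> enters either image after right multiplication by a
  nonzero element of that image, and powers of \<open>x\<close> achieve this. The obstacle is
  injectivity, since an algebra given by relations might collapse. Every element is therefore
  reduced to a combination of \<open>h^i (X^+)^j\<close> and \<open>h^i (X^-)^j\<close>, and the
  coefficients of its image in the skew Laurent ring recover the combination, because
  \<open>(a x^-1)^n\<close> is a nonzero polynomial times \<open>x^-n\<close>. The change of
  variable takes place inside the algebra on \<open>x, y\<close>: an element there is chosen to play
  the part of \<open>h\<close>, so that the automorphism is literally the given one and both
  algebras share the same \<open>S\<close>.\<close>

locale ore_domain =
  fixes S :: "'e::ring_1 set"
  assumes one_S: "1 \<in> S"
    and diff_S: "a \<in> S \<Longrightarrow> b \<in> S \<Longrightarrow> a - b \<in> S"
    and mult_S: "a \<in> S \<Longrightarrow> b \<in> S \<Longrightarrow> a * b \<in> S"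
    and no_zero_div: "a \<in> S \<Longrightarrow> b \<in> S \<Longrightarrow> a * b = 0 \<Longrightarrow> a = 0 \<or> b = 0"
    and ore: "a \<in> S \<Longrightarrow> b \<in> S \<Longrightarrow> a \<noteq> 0 \<Longrightarrow> b \<noteq> 0 \<Longrightarrow>
      \<exists>u\<in>S. \<exists>v\<in>S. a * u = b * v \<and> a * u \<noteq> 0"
begin

lemma cancel_left: "a \<in> S \<Longrightarrow> b \<in> S \<Longrightarrow> c \<in> S \<Longrightarrow> c \<noteq> 0 \<Longrightarrow> c * a = c * b \<Longrightarrow> a = b"
  using no_zero_div[of c "a - b"] diff_S by (auto simp: right_diff_distrib)

lemma cancel_right: "a \<in> S \<Longrightarrow> b \<in> S \<Longrightarrow> c \<in> S \<Longrightarrow> c \<noteq> 0 \<Longrightarrow> a * c = b * c \<Longrightarrow> a = b"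
  using no_zero_div[of "a - b" c] diff_S by (auto simp: left_diff_distrib)

lemma mult_nz: "a \<in> S \<Longrightarrow> b \<in> S \<Longrightarrow> a \<noteq> 0 \<Longrightarrow> b \<noteq> 0 \<Longrightarrow> a * b \<noteq> 0"
  using no_zero_div by blast

text \<open>The condition of \<open>frac_rel\<close>, but with cofactors from all of
  \<open>S\<close>; so fractions over different subalgebras of \<open>S\<close> can be
  compared.\<close>

definition frac_eq :: "'e \<Rightarrow> 'e \<Rightarrow> 'e \<Rightarrow> 'e \<Rightarrow> bool" where
  "frac_eq a s b t \<longleftrightarrow> (\<exists>u\<in>S. \<exists>v\<in>S. s * u = t * v \<and> s * u \<noteq> 0 \<and> a * u = b * v)"

text \<open>Equality of fractions can be tested on every common multiple of the denominators; all
  the compatibility statements below reduce to this.\<close>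

lemma frac_eqD:
  assumes eq: "frac_eq a s b t"
    and S: "a \<in> S" "s \<in> S" "b \<in> S" "t \<in> S" "u \<in> S" "v \<in> S" and nz: "s \<noteq> 0" "t \<noteq> 0"
    and uv: "s * u = t * v"
  shows "a * u = b * v"
proof (cases "u = 0")
  case True
  then have "v = 0" using no_zero_div[of t v] uv S nz by auto
  with True show ?thesis by simp
next
  case False
  from eq obtain p q where pq: "p \<in> S" "q \<in> S" "s * p = t * q" "s * p \<noteq> 0" "a * p = b * q"
    unfolding frac_eq_def by blast
  then have "p \<noteq> 0" by auto
  then obtain c d where cd: "c \<in> S" "d \<in> S" "u * c = p * d" "u * c \<noteq> 0"
    using ore[of u p] False S pq by blast
  have "t * (v * c) = s * (u * c)" using uv by (simp flip: mult.assoc)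
  also have "\<dots> = t * (q * d)" using cd pq by (simp flip: mult.assoc)
  finally have vc: "v * c = q * d"
    using cancel_left[of "v * c" "q * d" t] S pq cd nz mult_S by blast
  have "(a * u) * c = (a * p) * d" using cd by (simp add: mult.assoc)
  also have "\<dots> = (b * v) * c" using vc pq by (simp add: mult.assoc)
  finally show ?thesis
    using cancel_right[of "a * u" "b * v" c] S cd mult_S by fastforce
qed

lemma frac_eq_witness:
  "u \<in> S \<Longrightarrow> v \<in> S \<Longrightarrow> s * u = t * v \<Longrightarrow> s * u \<noteq> 0 \<Longrightarrow> a * u = b * v \<Longrightarrow> frac_eq a s b t"
  unfolding frac_eq_def by blast

lemma frac_eqI:
  assumes S: "s \<in> S" "t \<in> S" and nz: "s \<noteq> 0" "t \<noteq> 0"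
    and eq: "\<And>u v. u \<in> S \<Longrightarrow> v \<in> S \<Longrightarrow> s * u = t * v \<Longrightarrow> a * u = b * v"
  shows "frac_eq a s b t"
  using ore[OF S nz] eq unfolding frac_eq_def by blast

lemma frac_eq_refl: "s \<in> S \<Longrightarrow> s \<noteq> 0 \<Longrightarrow> frac_eq a s a s"
  by (rule frac_eq_witness[of 1 1]) (simp_all add: one_S)

lemma frac_eq_sym: "frac_eq a s b t \<Longrightarrow> frac_eq b t a s"
  unfolding frac_eq_def by metis

text \<open>A common multiple of \<open>s\<close> and \<open>t\<close> is extended to a multiple of
  \<open>r\<close>; there \<open>frac_eqD\<close> turns the second equality into an equation of
  numerators.\<close>

lemma frac_eq_trans:
  assumes 1: "frac_eq a s b t" and 2: "frac_eq b t c r"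
    and S: "a \<in> S" "s \<in> S" "b \<in> S" "t \<in> S" "c \<in> S" "r \<in> S" and nz: "s \<noteq> 0" "t \<noteq> 0" "r \<noteq> 0"
  shows "frac_eq a s c r"
proof -
  from 1 obtain u v where uv: "u \<in> S" "v \<in> S" "s * u = t * v" "s * u \<noteq> 0" "a * u = b * v"
    unfolding frac_eq_def by blast
  obtain w z where wz: "w \<in> S" "z \<in> S" "s * u * w = r * z" "s * u * w \<noteq> 0"
    using ore[of "s * u" r] S nz uv mult_S by blast
  have "b * (v * w) = c * z"
    using frac_eqD[OF 2, of "v * w" z] S nz uv wz mult_S by (simp flip: mult.assoc)
  then have "a * (u * w) = c * z" using uv by (simp flip: mult.assoc)
  moreover have "s * (u * w) = r * z" "s * (u * w) \<noteq> 0"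
    using wz(3,4) by (simp_all add: mult.assoc)
  ultimately show ?thesis
    using wz uv mult_S by (intro frac_eq_witness[of "u * w" z]) simp_all
qed

text \<open>By \<open>comm\<close>, a common multiple of the two denominators also yields one of
  \<open>s\<close> and \<open>s1\<close>, so \<open>frac_eqD\<close> applies first to the right
  factors and then to the left ones.\<close>

lemma frac_eq_mult:
  assumes eq: "frac_eq a s a1 s1" "frac_eq b t b1 t1"
    and S: "a \<in> S" "s \<in> S" "b \<in> S" "t \<in> S" "a1 \<in> S" "s1 \<in> S" "b1 \<in> S" "t1 \<in> S"
    and nz: "s \<noteq> 0" "t \<noteq> 0" "s1 \<noteq> 0" "t1 \<noteq> 0" "s' \<noteq> 0" "s1' \<noteq> 0"
    and S': "b' \<in> S" "s' \<in> S" "b1' \<in> S" "s1' \<in> S"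
    and comm: "s * b' = b * s'" "s1 * b1' = b1 * s1'"
  shows "frac_eq (a * b') (t * s') (a1 * b1') (t1 * s1')"
proof (rule frac_eqI)
  fix u v assume uv: "u \<in> S" "v \<in> S" "t * s' * u = t1 * s1' * v"
  have "b * (s' * u) = b1 * (s1' * v)"
    using frac_eqD[OF eq(2), of "s' * u" "s1' * v"] uv S S' nz mult_S by (simp add: mult.assoc)
  then have "s * (b' * u) = s1 * (b1' * v)"
    using comm by (simp flip: mult.assoc)
  then have "a * (b' * u) = a1 * (b1' * v)"
    using frac_eqD[OF eq(1), of "b' * u" "b1' * v"] uv S S' nz mult_S by simp
  then show "a * b' * u = a1 * b1' * v" by (simp add: mult.assoc)
qed (use S S' nz mult_S mult_nz in simp_all)

lemma frac_eq_add:
  assumes eq: "frac_eq a s a1 s1" "frac_eq b t b1 t1"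
    and S: "a \<in> S" "s \<in> S" "b \<in> S" "t \<in> S" "a1 \<in> S" "s1 \<in> S" "b1 \<in> S" "t1 \<in> S"
    and nz: "s \<noteq> 0" "t \<noteq> 0" "s1 \<noteq> 0" "t1 \<noteq> 0" "s * u \<noteq> 0" "s1 * u1 \<noteq> 0"
    and S': "u \<in> S" "v \<in> S" "u1 \<in> S" "v1 \<in> S"
    and comm: "s * u = t * v" "s1 * u1 = t1 * v1"
  shows "frac_eq (a * u + b * v) (s * u) (a1 * u1 + b1 * v1) (s1 * u1)"
proof (rule frac_eqI)
  fix x y assume xy: "x \<in> S" "y \<in> S" "s * u * x = s1 * u1 * y"
  have "a * (u * x) = a1 * (u1 * y)"
    using frac_eqD[OF eq(1), of "u * x" "u1 * y"] xy S S' nz mult_S by (simp add: mult.assoc)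
  moreover have "b * (v * x) = b1 * (v1 * y)"
    using frac_eqD[OF eq(2), of "v * x" "v1 * y"] xy comm S S' nz mult_S
    by (simp add: mult.assoc[symmetric])
  ultimately show "(a * u + b * v) * x = (a1 * u1 + b1 * v1) * y"
    by (simp add: distrib_right mult.assoc)
qed (use S S' nz mult_S mult_nz in simp_all)

lemma frac_eq_smult: "frac_eq a s b t \<Longrightarrow> frac_eq (c * a) s (c * b) t"
  unfolding frac_eq_def by (metis mult.assoc)

end

text \<open>Of \<open>A\<close> only closure is assumed: the ring laws are inherited from
  \<open>S\<close> through the injection \<open>F\<close>. By \<open>dense\<close>, every element of
  \<open>S\<close> is a right fraction over the image of \<open>F\<close>, so \<open>A\<close> and
  \<open>S\<close> have the same fractions.\<close>

locale frac_embedding = ore_domain S for S :: "'e::ring_1 set" +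
  fixes A :: "('k, 'a) module" and \<kappa> :: "'k \<Rightarrow> 'e" and F :: "'a \<Rightarrow> 'e"
  assumes closed: "\<one>\<^bsub>A\<^esub> \<in> carrier A" "\<zero>\<^bsub>A\<^esub> \<in> carrier A"
      "\<And>x y. x \<in> carrier A \<Longrightarrow> y \<in> carrier A \<Longrightarrow> x \<otimes>\<^bsub>A\<^esub> y \<in> carrier A"
      "\<And>x y. x \<in> carrier A \<Longrightarrow> y \<in> carrier A \<Longrightarrow> x \<oplus>\<^bsub>A\<^esub> y \<in> carrier A"
      "\<And>c x. x \<in> carrier A \<Longrightarrow> c \<odot>\<^bsub>A\<^esub> x \<in> carrier A"
    and F_one: "F \<one>\<^bsub>A\<^esub> = 1" and F_zero: "F \<zero>\<^bsub>A\<^esub> = 0"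
    and F_mult: "\<And>x y. x \<in> carrier A \<Longrightarrow> y \<in> carrier A \<Longrightarrow> F (x \<otimes>\<^bsub>A\<^esub> y) = F x * F y"
    and F_add: "\<And>x y. x \<in> carrier A \<Longrightarrow> y \<in> carrier A \<Longrightarrow> F (x \<oplus>\<^bsub>A\<^esub> y) = F x + F y"
    and F_smult: "\<And>c x. x \<in> carrier A \<Longrightarrow> F (c \<odot>\<^bsub>A\<^esub> x) = \<kappa> c * F x"
    and F_inj: "inj_on F (carrier A)"
    and F_S: "\<And>x. x \<in> carrier A \<Longrightarrow> F x \<in> S"
    and dense: "\<And>s. s \<in> S \<Longrightarrow> \<exists>c \<in> carrier A. F c \<noteq> 0 \<and> s * F c \<in> F ` carrier A"
begin

lemma F_eq: "x \<in> carrier A \<Longrightarrow> y \<in> carrier A \<Longrightarrow> F x = F y \<longleftrightarrow> x = y"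
  using F_inj by (auto dest: inj_onD)

lemma F_eq_0: "x \<in> carrier A \<Longrightarrow> F x = 0 \<longleftrightarrow> x = \<zero>\<^bsub>A\<^esub>"
  using F_eq[of x "\<zero>\<^bsub>A\<^esub>"] F_zero closed by simp

lemma pairs_iff: "(a, s) \<in> frac_pairs A \<longleftrightarrow> a \<in> carrier A \<and> s \<in> carrier A \<and> F s \<noteq> 0"
  unfolding frac_pairs_def using F_eq_0 by auto

text \<open>One multiplier \<open>w\<close> brings both elements into the image: \<open>c\<close>
  clears \<open>u\<close>, and \<open>d\<close> then clears \<open>v * F c\<close>.\<close>

lemma dense2:
  assumes "u \<in> S" "v \<in> S"
  shows "\<exists>u'\<in>carrier A. \<exists>v'\<in>carrier A. \<exists>w\<in>S. w \<noteq> 0 \<and> u * w = F u' \<and> v * w = F v'"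
proof -
  obtain c u' where c: "c \<in> carrier A" "F c \<noteq> 0" "u' \<in> carrier A" "u * F c = F u'"
    using dense[OF assms(1)] by auto
  obtain d v' where d: "d \<in> carrier A" "F d \<noteq> 0" "v' \<in> carrier A" "v * F c * F d = F v'"
    using dense[of "v * F c"] mult_S assms F_S c by blast
  have "F c * F d \<noteq> 0" using no_zero_div[of "F c" "F d"] F_S c d by blast
  moreover have "u * (F c * F d) = F (u' \<otimes>\<^bsub>A\<^esub> d)"
    using F_mult c d by (simp flip: mult.assoc)
  ultimately show ?thesis
    using c d closed mult_S F_S by (intro bexI[of _ "u' \<otimes>\<^bsub>A\<^esub> d"] bexI[of _ v'] bexI[of _ "F c * F d"])
      (auto simp: mult.assoc)
qed

text \<open>The cofactors found in \<open>S\<close> are multiplied by a common \<open>w\<close> that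
  moves both into the image.\<close>

lemma ore_A:
  assumes "a \<in> carrier A" "b \<in> carrier A" "F a \<noteq> 0" "F b \<noteq> 0"
  shows "\<exists>u\<in>carrier A. \<exists>v\<in>carrier A. a \<otimes>\<^bsub>A\<^esub> u = b \<otimes>\<^bsub>A\<^esub> v \<and> F (a \<otimes>\<^bsub>A\<^esub> u) \<noteq> 0"
proof -
  obtain u v where uv: "u \<in> S" "v \<in> S" "F a * u = F b * v" "F a * u \<noteq> 0"
    using ore[of "F a" "F b"] F_S assms by blast
  obtain u' v' w where w: "u' \<in> carrier A" "v' \<in> carrier A" "w \<in> S" "w \<noteq> 0" "u * w = F u'" "v * w = F v'"
    using dense2[OF uv(1,2)] by blast
  have "F (a \<otimes>\<^bsub>A\<^esub> u') = F a * u * w" "F (b \<otimes>\<^bsub>A\<^esub> v') = F b * v * w"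
    using w assms by (simp_all add: F_mult mult.assoc)
  moreover have "F a * u * w \<noteq> 0"
    using no_zero_div[of "F a * u" w] uv w F_S assms mult_S by blast
  ultimately show ?thesis using uv w assms closed F_eq
    by (metis (no_types, lifting))
qed

text \<open>Products of fractions need this form, since the numerator \<open>a\<close> may be zero;
  then \<open>u = 0\<close> and \<open>v = 1\<close> serve.\<close>

lemma right_common_multiple:
  assumes "s \<in> carrier A" "a \<in> carrier A" "F s \<noteq> 0"
  shows "\<exists>u\<in>carrier A. \<exists>v\<in>carrier A. s \<otimes>\<^bsub>A\<^esub> u = a \<otimes>\<^bsub>A\<^esub> v \<and> F v \<noteq> 0"
proof (cases "F a = 0")
  case True
  have "F (s \<otimes>\<^bsub>A\<^esub> \<zero>\<^bsub>A\<^esub>) = F (a \<otimes>\<^bsub>A\<^esub> \<one>\<^bsub>A\<^esub>)"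
    using True assms closed by (simp add: F_mult F_zero)
  then have "s \<otimes>\<^bsub>A\<^esub> \<zero>\<^bsub>A\<^esub> = a \<otimes>\<^bsub>A\<^esub> \<one>\<^bsub>A\<^esub>"
    using assms closed by (simp add: F_eq)
  moreover have "F \<one>\<^bsub>A\<^esub> \<noteq> 0" using F_one assms(3) by (metis mult_1 mult_zero_left)
  ultimately show ?thesis using closed by blast
next
  case False
  then obtain u v where "u \<in> carrier A" "v \<in> carrier A" "s \<otimes>\<^bsub>A\<^esub> u = a \<otimes>\<^bsub>A\<^esub> v" "F (s \<otimes>\<^bsub>A\<^esub> u) \<noteq> 0"
    using ore_A[of s a] assms by blast
  moreover from this have "F v \<noteq> 0" using assms by (auto simp: F_mult)
  ultimately show ?thesis by blast
qed

section \<open>Fraction classes of an embedded algebra and their arithmetic\<close>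

lemma frac_rel_iff:
  "((a, s), (b, t)) \<in> frac_rel A \<longleftrightarrow>
    (a, s) \<in> frac_pairs A \<and> (b, t) \<in> frac_pairs A \<and> frac_eq (F a) (F s) (F b) (F t)"
proof (intro iffI conjI; (elim conjE)?)
  assume "((a, s), (b, t)) \<in> frac_rel A"
  then obtain u v where *: "(a, s) \<in> frac_pairs A" "(b, t) \<in> frac_pairs A" "u \<in> carrier A" "v \<in> carrier A"
    "s \<otimes>\<^bsub>A\<^esub> u = t \<otimes>\<^bsub>A\<^esub> v" "s \<otimes>\<^bsub>A\<^esub> u \<noteq> \<zero>\<^bsub>A\<^esub>" "a \<otimes>\<^bsub>A\<^esub> u = b \<otimes>\<^bsub>A\<^esub> v"
    unfolding frac_rel_def by auto
  then show "(a, s) \<in> frac_pairs A" "(b, t) \<in> frac_pairs A" by auto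
  have "F s * F u = F t * F v" "F s * F u \<noteq> 0" "F a * F u = F b * F v"
    using * by (simp_all add: pairs_iff flip: F_mult) (use * F_eq_0 closed pairs_iff in blast)
  then show "frac_eq (F a) (F s) (F b) (F t)" using * F_S unfolding frac_eq_def by blast
next
  assume *: "(a, s) \<in> frac_pairs A" "(b, t) \<in> frac_pairs A" "frac_eq (F a) (F s) (F b) (F t)"
  \<comment> \<open>The cofactors behind \<open>frac_eq\<close> may lie outside the image;
    \<open>ore_A\<close> supplies a common multiple over \<open>A\<close>, and
    \<open>frac_eqD\<close> holds on every common multiple.\<close>
  then obtain u v where uv: "u \<in> carrier A" "v \<in> carrier A" "s \<otimes>\<^bsub>A\<^esub> u = t \<otimes>\<^bsub>A\<^esub> v" "F (s \<otimes>\<^bsub>A\<^esub> u) \<noteq> 0"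
    using ore_A[of s t] pairs_iff by blast
  then have "F s * F u = F t * F v" using * by (simp add: pairs_iff flip: F_mult)
  then have "F a * F u = F b * F v"
    using frac_eqD[OF *(3)] F_S * uv pairs_iff by blast
  then have "a \<otimes>\<^bsub>A\<^esub> u = b \<otimes>\<^bsub>A\<^esub> v" using * uv closed F_eq by (simp add: pairs_iff flip: F_mult)
  then show "((a, s), (b, t)) \<in> frac_rel A" using * uv F_zero unfolding frac_rel_def by fastforce
qed

lemma mem_class:
  "(a, s) \<in> frac_pairs A \<Longrightarrow>
    (b, t) \<in> frac_class A a s \<longleftrightarrow> (b, t) \<in> frac_pairs A \<and> frac_eq (F a) (F s) (F b) (F t)"
  unfolding frac_class_def using frac_rel_iff by auto

lemma class_eq:
  assumes "(a, s) \<in> frac_pairs A" "(b, t) \<in> frac_pairs A" "frac_eq (F a) (F s) (F b) (F t)"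
  shows "frac_class A a s = frac_class A b t"
proof -
  have S: "F a \<in> S" "F s \<in> S" "F b \<in> S" "F t \<in> S" "F s \<noteq> 0" "F t \<noteq> 0"
    using assms F_S by (simp_all add: pairs_iff)
  have "frac_eq (F a) (F s) (F c) (F r) \<longleftrightarrow> frac_eq (F b) (F t) (F c) (F r)"
    if "(c, r) \<in> frac_pairs A" for c r
  proof -
    have cr: "F c \<in> S" "F r \<in> S" "F r \<noteq> 0" using that F_S by (simp_all add: pairs_iff)
    show ?thesis
      using frac_eq_trans[OF assms(3) _ S(1-4) cr(1,2) S(5,6) cr(3)]
        frac_eq_trans[OF frac_eq_sym[OF assms(3)] _ S(3,4,1,2) cr(1,2) S(6,5) cr(3)] by blast
  qed
  then show ?thesis
    using mem_class[OF assms(1)] mem_class[OF assms(2)] by auto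
qed

lemma class_self: "(a, s) \<in> frac_pairs A \<Longrightarrow> (a, s) \<in> frac_class A a s"
  using mem_class frac_eq_refl F_S pairs_iff by blast

lemma carrier_Frac: "carrier (Frac A) = {frac_class A a s | a s. (a, s) \<in> frac_pairs A}"
  unfolding Frac_def quotient_def frac_class_def by auto

text \<open>The operations of \<open>Frac\<close> are unions over all representatives and auxiliary
  elements; such a union is a single class once all its members coincide.\<close>

lemma Union_class_eq:
  assumes "\<And>X. X \<in> \<X> \<Longrightarrow> X = Y" "Y \<in> \<X>"
  shows "\<Union> \<X> = Y"
  using assms by blast

text \<open>Any admissible \<open>b'\<close> and \<open>s'\<close> compute the product: by
  \<open>frac_eq_mult\<close> all choices in the union give the same class.\<close>

lemma frac_mult_class:
  assumes ab: "(a, s) \<in> frac_pairs A" "(b, t) \<in> frac_pairs A"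
    and b': "b' \<in> carrier A" "s' \<in> carrier A" "F s' \<noteq> 0" "s \<otimes>\<^bsub>A\<^esub> b' = b \<otimes>\<^bsub>A\<^esub> s'"
  shows "frac_mult A (frac_class A a s) (frac_class A b t) = frac_class A (a \<otimes>\<^bsub>A\<^esub> b') (t \<otimes>\<^bsub>A\<^esub> s')"
    (is "_ = ?Y")
  unfolding frac_mult_def
proof (rule Union_class_eq)
  show "?Y \<in> {frac_class A (c \<otimes>\<^bsub>A\<^esub> d') (q \<otimes>\<^bsub>A\<^esub> r') | c r d q d' r'.
      (c, r) \<in> frac_class A a s \<and> (d, q) \<in> frac_class A b t \<and>
      d' \<in> carrier A \<and> r' \<in> carrier A - {\<zero>\<^bsub>A\<^esub>} \<and> r \<otimes>\<^bsub>A\<^esub> d' = d \<otimes>\<^bsub>A\<^esub> r'}"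
    by (rule CollectI, rule exI[of _ a], rule exI[of _ s], rule exI[of _ b], rule exI[of _ t],
        rule exI[of _ b'], rule exI[of _ s'])
      (use class_self[OF ab(1)] class_self[OF ab(2)] b' F_zero in auto)
next
  have F_ne: "F (x \<otimes>\<^bsub>A\<^esub> y) \<noteq> 0" if "x \<in> carrier A" "y \<in> carrier A" "F x \<noteq> 0" "F y \<noteq> 0" for x y
    using that F_S by (simp add: F_mult mult_nz)
  fix X assume "X \<in> {frac_class A (c \<otimes>\<^bsub>A\<^esub> d') (q \<otimes>\<^bsub>A\<^esub> r') | c r d q d' r'.
      (c, r) \<in> frac_class A a s \<and> (d, q) \<in> frac_class A b t \<and>
      d' \<in> carrier A \<and> r' \<in> carrier A - {\<zero>\<^bsub>A\<^esub>} \<and> r \<otimes>\<^bsub>A\<^esub> d' = d \<otimes>\<^bsub>A\<^esub> r'}"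
  then obtain a1 s1 b1 t1 b1' s1' where X: "X = frac_class A (a1 \<otimes>\<^bsub>A\<^esub> b1') (t1 \<otimes>\<^bsub>A\<^esub> s1')"
    and 1: "(a1, s1) \<in> frac_class A a s" "(b1, t1) \<in> frac_class A b t"
      "b1' \<in> carrier A" "s1' \<in> carrier A" "s1' \<noteq> \<zero>\<^bsub>A\<^esub>" "s1 \<otimes>\<^bsub>A\<^esub> b1' = b1 \<otimes>\<^bsub>A\<^esub> s1'"
    by blast
  have 2: "(a1, s1) \<in> frac_pairs A" "(b1, t1) \<in> frac_pairs A" 
    "frac_eq (F a1) (F s1) (F a) (F s)" "frac_eq (F b1) (F t1) (F b) (F t)"
    using 1(1,2) by (simp_all add: mem_class[OF ab(1)] mem_class[OF ab(2)] frac_eq_sym)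
  have 3: "F s1' \<noteq> 0" using 1 F_eq_0 by blast
  have comm: "F s1 * F b1' = F b1 * F s1'" "F s * F b' = F b * F s'"
    using 1 2 b' ab by (simp_all add: pairs_iff flip: F_mult)
  have "frac_eq (F a1 * F b1') (F t1 * F s1') (F a * F b') (F t * F s')"
    by (rule frac_eq_mult[OF 2(3,4)]) (use 1 2 3 ab b' comm F_S pairs_iff in blast)+
  then show "X = ?Y" unfolding X
    using 1 2 3 ab b' closed F_ne by (intro class_eq) (simp_all add: pairs_iff F_mult)
qed

lemma frac_add_class:
  assumes ab: "(a, s) \<in> frac_pairs A" "(b, t) \<in> frac_pairs A"
    and uv: "u \<in> carrier A" "v \<in> carrier A" "F (s \<otimes>\<^bsub>A\<^esub> u) \<noteq> 0" "s \<otimes>\<^bsub>A\<^esub> u = t \<otimes>\<^bsub>A\<^esub> v"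
  shows "frac_add A (frac_class A a s) (frac_class A b t) =
    frac_class A (a \<otimes>\<^bsub>A\<^esub> u \<oplus>\<^bsub>A\<^esub> b \<otimes>\<^bsub>A\<^esub> v) (s \<otimes>\<^bsub>A\<^esub> u)"
    (is "_ = ?Y")
  unfolding frac_add_def
proof (rule Union_class_eq)
  show "?Y \<in> {frac_class A (c \<otimes>\<^bsub>A\<^esub> u \<oplus>\<^bsub>A\<^esub> d \<otimes>\<^bsub>A\<^esub> v) (r \<otimes>\<^bsub>A\<^esub> u) | c r d q u v.
      (c, r) \<in> frac_class A a s \<and> (d, q) \<in> frac_class A b t \<and> u \<in> carrier A \<and> v \<in> carrier A \<and>
      r \<otimes>\<^bsub>A\<^esub> u = q \<otimes>\<^bsub>A\<^esub> v \<and> r \<otimes>\<^bsub>A\<^esub> u \<noteq> \<zero>\<^bsub>A\<^esub>}"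
    by (rule CollectI, rule exI[of _ a], rule exI[of _ s], rule exI[of _ b], rule exI[of _ t],
        rule exI[of _ u], rule exI[of _ v])
      (use class_self[OF ab(1)] class_self[OF ab(2)] uv F_zero in auto)
next
  fix X assume "X \<in> {frac_class A (c \<otimes>\<^bsub>A\<^esub> u \<oplus>\<^bsub>A\<^esub> d \<otimes>\<^bsub>A\<^esub> v) (r \<otimes>\<^bsub>A\<^esub> u) | c r d q u v.
      (c, r) \<in> frac_class A a s \<and> (d, q) \<in> frac_class A b t \<and> u \<in> carrier A \<and> v \<in> carrier A \<and>
      r \<otimes>\<^bsub>A\<^esub> u = q \<otimes>\<^bsub>A\<^esub> v \<and> r \<otimes>\<^bsub>A\<^esub> u \<noteq> \<zero>\<^bsub>A\<^esub>}"
  then obtain a1 s1 b1 t1 u1 v1 where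
    X: "X = frac_class A (a1 \<otimes>\<^bsub>A\<^esub> u1 \<oplus>\<^bsub>A\<^esub> b1 \<otimes>\<^bsub>A\<^esub> v1) (s1 \<otimes>\<^bsub>A\<^esub> u1)"
    and 1: "(a1, s1) \<in> frac_class A a s" "(b1, t1) \<in> frac_class A b t"
      "u1 \<in> carrier A" "v1 \<in> carrier A" "s1 \<otimes>\<^bsub>A\<^esub> u1 = t1 \<otimes>\<^bsub>A\<^esub> v1" "s1 \<otimes>\<^bsub>A\<^esub> u1 \<noteq> \<zero>\<^bsub>A\<^esub>"
    by blast
  have 2: "(a1, s1) \<in> frac_pairs A" "(b1, t1) \<in> frac_pairs A" 
    "frac_eq (F a1) (F s1) (F a) (F s)" "frac_eq (F b1) (F t1) (F b) (F t)"
    using 1(1,2) by (simp_all add: mem_class[OF ab(1)] mem_class[OF ab(2)] frac_eq_sym)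
  have 3: "F (s1 \<otimes>\<^bsub>A\<^esub> u1) \<noteq> 0" 
    using 1(3,6) 2(1) closed(3)[of s1 u1] by (simp add: F_eq_0 pairs_iff)
  then have 4: "F s1 * F u1 \<noteq> 0" "F s * F u \<noteq> 0"
    using 1 2 uv ab by (simp_all add: pairs_iff flip: F_mult)
  have comm: "F s1 * F u1 = F t1 * F v1" "F s * F u = F t * F v"
    using 1 2 uv ab by (simp_all add: pairs_iff flip: F_mult)
  have "frac_eq (F a1 * F u1 + F b1 * F v1) (F s1 * F u1) (F a * F u + F b * F v) (F s * F u)"
    by (rule frac_eq_add[OF 2(3,4)]) (use 1 2 4 ab uv comm F_S pairs_iff in blast)+
  then show "X = ?Y" unfolding X
    using 1 2 4 ab uv comm closed by (intro class_eq) (simp_all add: pairs_iff F_mult F_add)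
qed

lemma frac_smult_class:
  assumes "(a, s) \<in> frac_pairs A"
  shows "c \<odot>\<^bsub>Frac A\<^esub> frac_class A a s = frac_class A (c \<odot>\<^bsub>A\<^esub> a) s"
proof -
  have "\<Union> {frac_class A (c \<odot>\<^bsub>A\<^esub> b) t | b t. (b, t) \<in> frac_class A a s} = frac_class A (c \<odot>\<^bsub>A\<^esub> a) s"
  proof (rule Union_class_eq)
    fix X assume "X \<in> {frac_class A (c \<odot>\<^bsub>A\<^esub> b) t | b t. (b, t) \<in> frac_class A a s}"
    then obtain b t where X: "X = frac_class A (c \<odot>\<^bsub>A\<^esub> b) t"
      and 1: "(b, t) \<in> frac_pairs A" "frac_eq (F a) (F s) (F b) (F t)"
      using mem_class assms by blast
    then have "frac_eq (\<kappa> c * F b) (F t) (\<kappa> c * F a) (F s)" using frac_eq_smult frac_eq_sym by blast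
    then show "X = frac_class A (c \<odot>\<^bsub>A\<^esub> a) s" unfolding X
      using 1 assms closed by (intro class_eq) (auto simp: pairs_iff F_smult)
  qed (use class_self[OF assms] in blast)
  then show ?thesis by (simp add: Frac_def)
qed

end

section \<open>Comparison of the fractions of two algebras in one Ore domain\<close>

locale frac_embedding2 = A: frac_embedding S A \<kappa> F + B: frac_embedding S B \<kappa> G
  for S :: "'e::ring_1 set" and A :: "('k, 'a) module" and B :: "('k, 'b) module" and \<kappa> F G
begin

text \<open>A class over \<open>A\<close> goes to all pairs over \<open>B\<close> that represent the
  same fraction in \<open>S\<close>; no choice of representatives is involved.\<close>

definition transfer :: "('a \<times> 'a) set \<Rightarrow> ('b \<times> 'b) set" where
  "transfer P = {(b, t) \<in> frac_pairs B. \<exists>(a, s) \<in> P. A.frac_eq (F a) (F s) (G b) (G t)}"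

lemma transfer_class:
  assumes as: "(a, s) \<in> frac_pairs A" and bt: "(b, t) \<in> frac_pairs B"
    and eq: "A.frac_eq (F a) (F s) (G b) (G t)"
  shows "transfer (frac_class A a s) = frac_class B b t"
proof -
  have "(\<exists>(a', s') \<in> frac_class A a s. A.frac_eq (F a') (F s') (G c) (G r)) \<longleftrightarrow>
      A.frac_eq (G b) (G t) (G c) (G r)" if cr: "(c, r) \<in> frac_pairs B" for c r
  proof
    assume "\<exists>(a', s') \<in> frac_class A a s. A.frac_eq (F a') (F s') (G c) (G r)"
    then obtain a' s' where 1: "(a', s') \<in> frac_pairs A" "A.frac_eq (F a) (F s) (F a') (F s')"
      "A.frac_eq (F a') (F s') (G c) (G r)"
      using A.mem_class[OF as] by blast
    have "A.frac_eq (F a) (F s) (G c) (G r)"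
      by (rule A.frac_eq_trans[OF 1(2,3)])
        (use as 1 cr A.F_S B.F_S A.pairs_iff B.pairs_iff in blast)+
    then show "A.frac_eq (G b) (G t) (G c) (G r)"
      by (rule A.frac_eq_trans[OF A.frac_eq_sym[OF eq]])
        (use as bt cr A.F_S B.F_S A.pairs_iff B.pairs_iff in blast)+
  next
    assume 1: "A.frac_eq (G b) (G t) (G c) (G r)"
    have "A.frac_eq (F a) (F s) (G c) (G r)"
      by (rule A.frac_eq_trans[OF eq 1])
        (use as bt cr A.F_S B.F_S A.pairs_iff B.pairs_iff in blast)+
    then show "\<exists>(a', s') \<in> frac_class A a s. A.frac_eq (F a') (F s') (G c) (G r)"
      using A.class_self[OF as] by blast
  qed
  then show ?thesis unfolding transfer_def using B.mem_class[OF bt] by fast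
qed

text \<open>Numerator and denominator are expanded by one element \<open>w\<close> that moves both
  into the image of \<open>B\<close>.\<close>

lemma ex_transfer:
  assumes "(a, s) \<in> frac_pairs A"
  shows "\<exists>b t. (b, t) \<in> frac_pairs B \<and> A.frac_eq (F a) (F s) (G b) (G t)"
proof -
  have 1: "F a \<in> S" "F s \<in> S" "F s \<noteq> 0" using assms A.F_S A.pairs_iff by blast+
  then obtain b t w where bt: "b \<in> carrier B" "t \<in> carrier B" "w \<in> S" "w \<noteq> 0"
    "F a * w = G b" "F s * w = G t"
    using B.dense2 by blast
  then have nz: "G t \<noteq> 0" using A.no_zero_div 1 by metis
  then have "A.frac_eq (F a) (F s) (G b) (G t)"
    unfolding A.frac_eq_def using bt A.one_S by (intro bexI[of _ w] bexI[of _ 1]) auto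
  then show ?thesis using bt nz B.pairs_iff by blast
qed

lemma transfer_mem:
  assumes "P \<in> carrier (Frac A)"
  obtains a s b t where "(a, s) \<in> frac_pairs A" "(b, t) \<in> frac_pairs B"
    "A.frac_eq (F a) (F s) (G b) (G t)" "P = frac_class A a s" "transfer P = frac_class B b t"
proof -
  obtain a s where 1: "(a, s) \<in> frac_pairs A" "P = frac_class A a s"
    using assms A.carrier_Frac by blast
  then obtain b t where "(b, t) \<in> frac_pairs B" "A.frac_eq (F a) (F s) (G b) (G t)"
    using ex_transfer by blast
  with 1 show ?thesis using that transfer_class by blast
qed

text \<open>Each side is computed with auxiliary elements of its own algebra; the two results agree
  as fractions in \<open>S\<close> by \<open>frac_eq_mult\<close>.\<close>

lemma transfer_mult:
  assumes "P \<in> carrier (Frac A)" "Q \<in> carrier (Frac A)"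
  shows "transfer (frac_mult A P Q) = frac_mult B (transfer P) (transfer Q)"
proof -
  obtain a s b t where 1: "(a, s) \<in> frac_pairs A" "(b, t) \<in> frac_pairs B"
    "A.frac_eq (F a) (F s) (G b) (G t)" "P = frac_class A a s" "transfer P = frac_class B b t"
    by (rule transfer_mem[OF assms(1)])
  obtain a' s' b' t' where 2: "(a', s') \<in> frac_pairs A" "(b', t') \<in> frac_pairs B"
    "A.frac_eq (F a') (F s') (G b') (G t')" "Q = frac_class A a' s'" "transfer Q = frac_class B b' t'"
    by (rule transfer_mem[OF assms(2)])
  obtain u v where uv: "u \<in> carrier A" "v \<in> carrier A" "s \<otimes>\<^bsub>A\<^esub> u = a' \<otimes>\<^bsub>A\<^esub> v" "F v \<noteq> 0"
    using A.right_common_multiple[of s a'] 1 2 A.pairs_iff by blast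
  obtain x y where xy: "x \<in> carrier B" "y \<in> carrier B" "t \<otimes>\<^bsub>B\<^esub> x = b' \<otimes>\<^bsub>B\<^esub> y" "G y \<noteq> 0"
    using B.right_common_multiple[of t b'] 1 2 B.pairs_iff by blast
  have comm: "F s * F u = F a' * F v" "G t * G x = G b' * G y"
    using 1 2 uv xy by (simp_all add: A.pairs_iff B.pairs_iff flip: A.F_mult B.F_mult)
  have eq: "A.frac_eq (F a * F u) (F s' * F v) (G b * G x) (G t' * G y)"
    by (rule A.frac_eq_mult[OF 1(3) 2(3)])
      (use 1 2 uv xy comm A.F_S B.F_S A.pairs_iff B.pairs_iff in blast)+
  have nz: "F s' * F v \<noteq> 0" "G t' * G y \<noteq> 0"
    using 1 2 uv xy A.F_S B.F_S by (simp_all add: A.mult_nz A.pairs_iff B.pairs_iff)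
  have "transfer (frac_class A (a \<otimes>\<^bsub>A\<^esub> u) (s' \<otimes>\<^bsub>A\<^esub> v)) = frac_class B (b \<otimes>\<^bsub>B\<^esub> x) (t' \<otimes>\<^bsub>B\<^esub> y)"
    using 1 2 uv xy eq nz A.closed B.closed
    by (intro transfer_class) (simp_all add: A.pairs_iff B.pairs_iff A.F_mult B.F_mult)
  then show ?thesis
    using A.frac_mult_class[OF 1(1) 2(1) uv(1,2,4,3)] B.frac_mult_class[OF 1(2) 2(2) xy(1,2,4,3)] 1 2
    by simp
qed

lemma transfer_add:
  assumes "P \<in> carrier (Frac A)" "Q \<in> carrier (Frac A)"
  shows "transfer (frac_add A P Q) = frac_add B (transfer P) (transfer Q)"
proof -
  obtain a s b t where 1: "(a, s) \<in> frac_pairs A" "(b, t) \<in> frac_pairs B"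
    "A.frac_eq (F a) (F s) (G b) (G t)" "P = frac_class A a s" "transfer P = frac_class B b t"
    by (rule transfer_mem[OF assms(1)])
  obtain a' s' b' t' where 2: "(a', s') \<in> frac_pairs A" "(b', t') \<in> frac_pairs B"
    "A.frac_eq (F a') (F s') (G b') (G t')" "Q = frac_class A a' s'" "transfer Q = frac_class B b' t'"
    by (rule transfer_mem[OF assms(2)])
  obtain u v where uv: "u \<in> carrier A" "v \<in> carrier A" "s \<otimes>\<^bsub>A\<^esub> u = s' \<otimes>\<^bsub>A\<^esub> v" "F (s \<otimes>\<^bsub>A\<^esub> u) \<noteq> 0"
    using A.ore_A[of s s'] 1 2 A.pairs_iff by blast
  obtain x y where xy: "x \<in> carrier B" "y \<in> carrier B" "t \<otimes>\<^bsub>B\<^esub> x = t' \<otimes>\<^bsub>B\<^esub> y" "G (t \<otimes>\<^bsub>B\<^esub> x) \<noteq> 0"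
    using B.ore_A[of t t'] 1 2 B.pairs_iff by blast
  have comm: "F s * F u = F s' * F v" "G t * G x = G t' * G y"
    "F s * F u \<noteq> 0" "G t * G x \<noteq> 0"
    using 1 2 uv xy by (simp_all add: A.pairs_iff B.pairs_iff flip: A.F_mult B.F_mult)
  have eq: "A.frac_eq (F a * F u + F a' * F v) (F s * F u) (G b * G x + G b' * G y) (G t * G x)"
    by (rule A.frac_eq_add[OF 1(3) 2(3)])
      (use 1 2 uv xy comm A.F_S B.F_S A.pairs_iff B.pairs_iff in blast)+
  have "transfer (frac_class A (a \<otimes>\<^bsub>A\<^esub> u \<oplus>\<^bsub>A\<^esub> a' \<otimes>\<^bsub>A\<^esub> v) (s \<otimes>\<^bsub>A\<^esub> u)) =
      frac_class B (b \<otimes>\<^bsub>B\<^esub> x \<oplus>\<^bsub>B\<^esub> b' \<otimes>\<^bsub>B\<^esub> y) (t \<otimes>\<^bsub>B\<^esub> x)"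
    using 1 2 uv xy comm eq A.closed B.closed
    by (intro transfer_class)
      (simp_all add: A.pairs_iff B.pairs_iff A.F_mult B.F_mult A.F_add B.F_add)
  then show ?thesis
    using A.frac_add_class[OF 1(1) 2(1) uv(1,2,4,3)] B.frac_add_class[OF 1(2) 2(2) xy(1,2,4,3)] 1 2
    by simp
qed

lemma transfer_smult:
  assumes "P \<in> carrier (Frac A)"
  shows "transfer (c \<odot>\<^bsub>Frac A\<^esub> P) = c \<odot>\<^bsub>Frac B\<^esub> transfer P"
proof -
  obtain a s b t where 1: "(a, s) \<in> frac_pairs A" "(b, t) \<in> frac_pairs B"
    "A.frac_eq (F a) (F s) (G b) (G t)" "P = frac_class A a s" "transfer P = frac_class B b t"
    by (rule transfer_mem[OF assms])
  have "transfer (frac_class A (c \<odot>\<^bsub>A\<^esub> a) s) = frac_class B (c \<odot>\<^bsub>B\<^esub> b) t"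
    using 1 A.closed B.closed A.frac_eq_smult[OF 1(3), of "\<kappa> c"]
    by (intro transfer_class) (simp_all add: A.pairs_iff B.pairs_iff A.F_smult B.F_smult)
  then show ?thesis using 1 A.frac_smult_class B.frac_smult_class by simp
qed

lemma transfer_one: "transfer \<one>\<^bsub>Frac A\<^esub> = \<one>\<^bsub>Frac B\<^esub>"
  unfolding Frac_def using A.closed B.closed A.one_S
  by (simp, intro transfer_class)
    (simp_all add: A.pairs_iff B.pairs_iff A.F_one B.F_one A.frac_eq_refl)

end

text \<open>The inverse is the same \<open>transfer\<close> with \<open>A\<close> and
  \<open>B\<close> exchanged, as equality of fractions in \<open>S\<close> is symmetric.\<close>

theorem (in frac_embedding2) Frac_isomorphic: "Frac A \<simeq>\<^sub>a Frac B"
proof -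
  interpret BA: frac_embedding2 S B A \<kappa> G F ..
  have closed: "transfer P \<in> carrier (Frac B)" and inv: "BA.transfer (transfer P) = P"
    if P: "P \<in> carrier (Frac A)" for P
  proof -
    obtain a s b t where 1: "(a, s) \<in> frac_pairs A" "(b, t) \<in> frac_pairs B"
      "A.frac_eq (F a) (F s) (G b) (G t)" "P = frac_class A a s" "transfer P = frac_class B b t"
      by (rule transfer_mem[OF P])
    show "transfer P \<in> carrier (Frac B)" unfolding 1(5) B.carrier_Frac using 1(2) by blast
    show "BA.transfer (transfer P) = P"
      unfolding 1(5) using BA.transfer_class[OF 1(2,1) A.frac_eq_sym[OF 1(3)]] 1(4) by simp
  qed
  have closed': "BA.transfer P \<in> carrier (Frac A)" and inv': "transfer (BA.transfer P) = P"
    if P: "P \<in> carrier (Frac B)" for P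
  proof -
    obtain b t a s where 1: "(b, t) \<in> frac_pairs B" "(a, s) \<in> frac_pairs A"
      "A.frac_eq (G b) (G t) (F a) (F s)" "P = frac_class B b t" "BA.transfer P = frac_class A a s"
      by (rule BA.transfer_mem[OF P])
    show "BA.transfer P \<in> carrier (Frac A)" unfolding 1(5) A.carrier_Frac using 1(2) by blast
    show "transfer (BA.transfer P) = P"
      unfolding 1(5) using transfer_class[OF 1(2,1) A.frac_eq_sym[OF 1(3)]] 1(4) by simp
  qed
  have "bij_betw transfer (carrier (Frac A)) (carrier (Frac B))"
    by (rule bij_betw_byWitness[where f' = BA.transfer]) (use closed closed' inv inv' in auto)
  moreover have "transfer \<in> ring_hom (Frac A) (Frac B)"
    by (rule ring_hom_memI) (use closed transfer_one transfer_mult transfer_add in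
      \<open>simp_all add: Frac_def\<close>)
  ultimately have "transfer \<in> alg_iso (Frac A) (Frac B)"
    unfolding alg_iso_def ring_iso_def using transfer_smult by simp
  then show ?thesis unfolding alg_isomorphic_def by blast
qed

section \<open>Skew Laurent polynomials as operators\<close>

text \<open>The skew Laurent ring acts on families \<open>\<int> \<Rightarrow> k[h]\<close> (the coefficients of formal series
  \<open>\<Sum> u\<^sub>n x\<^sup>n\<close>) by left multiplication. Working with operators makes the ring laws trivial, and
  applying an operator to the family of the unit element recovers its coefficients.\<close>

typedef (overloaded) 'k opr =
  "{f :: (int \<Rightarrow> 'k::comm_ring_1 poly) \<Rightarrow> int \<Rightarrow> 'k poly. \<forall>u v. f (\<lambda>n. u n + v n) = (\<lambda>n. f u n + f v n)}"
  morphisms app Opr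
  by (rule exI[of _ "\<lambda>u. u"]) simp

lifting_forget poly.lifting
setup_lifting type_definition_opr

instantiation opr :: (comm_ring_1) ring_1
begin

lift_definition zero_opr :: "'a opr" is "\<lambda>u n. 0" by simp
lift_definition one_opr :: "'a opr" is "\<lambda>u. u" by simp
lift_definition plus_opr :: "'a opr \<Rightarrow> 'a opr \<Rightarrow> 'a opr" is "\<lambda>f g u n. f u n + g u n"
  by (simp add: algebra_simps)
lift_definition minus_opr :: "'a opr \<Rightarrow> 'a opr \<Rightarrow> 'a opr" is "\<lambda>f g u n. f u n - g u n"
  by (simp add: algebra_simps)
lift_definition uminus_opr :: "'a opr \<Rightarrow> 'a opr" is "\<lambda>f u n. - f u n"
  by (simp add: algebra_simps)
lift_definition times_opr :: "'a opr \<Rightarrow> 'a opr \<Rightarrow> 'a opr" is "\<lambda>f g u. f (g u)"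
  by simp

instance
proof
  show "(0::'a opr) \<noteq> 1"
  proof
    assume "(0::'a opr) = 1"
    then have "app (0::'a opr) (\<lambda>_. 1) 0 = app (1::'a opr) (\<lambda>_. 1) 0" by simp
    then show False by (simp add: zero_opr.rep_eq one_opr.rep_eq)
  qed
qed (transfer; simp add: algebra_simps)+

end

lift_definition mulop :: "'k::comm_ring_1 poly \<Rightarrow> 'k opr" is "\<lambda>p u n. p * u n"
  by (simp add: algebra_simps)

text \<open>In terms of series, \<open>x\<close> sends \<open>\<Sum> u_n x^n\<close> to
  \<open>\<Sum> \<sigma>(u_n) x^(n+1)\<close>, where \<sigma> is substitution of \<open>s\<close>;
  \<open>k = -1\<close> with the inverse substitution gives \<open>x^-1\<close>.\<close>

lift_definition twisted_shift :: "int \<Rightarrow> 'k::comm_ring_1 poly \<Rightarrow> 'k opr" is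
  "\<lambda>k s u n. pcompose (u (n - k)) s"
  by (simp add: pcompose_add)

lemma mulop_0 [simp]: "mulop 0 = 0"
  by transfer simp

lemma mulop_1 [simp]: "mulop 1 = 1"
  by transfer simp

lemma mulop_add: "mulop (p + q) = mulop p + mulop q"
  by transfer (simp add: algebra_simps)

lemma mulop_diff: "mulop (p - q) = mulop p - mulop q"
  by transfer (simp add: algebra_simps)

lemma mulop_minus_1: "mulop (- 1) = - 1"
  using mulop_diff[of 0 1] by simp

lemma mulop_mult: "mulop (p * q) = mulop p * mulop q"
  by transfer (simp add: algebra_simps)

definition cf :: "'k::comm_ring_1 opr \<Rightarrow> int \<Rightarrow> 'k poly" where
  "cf z = app z (\<lambda>n. if n = 0 then 1 else 0)"

lemma cf_0 [simp]: "cf 0 n = 0"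
  by (simp add: cf_def zero_opr.rep_eq)

lemma cf_add: "cf (z + w) n = cf z n + cf w n"
  by (simp add: cf_def plus_opr.rep_eq)

lemma cf_mulop: "cf (mulop p * z) n = p * cf z n"
  by (simp add: cf_def times_opr.rep_eq mulop.rep_eq)

text \<open>\<open>s\<close> and \<open>s'\<close> are the images of \<open>h\<close> under \<sigma>
  and its inverse, so that \<open>\<sigma>(p)\<close> is \<open>pcompose p s\<close>.\<close>

locale skew_laurent =
  fixes s s' :: "'k::field poly"
  assumes ss': "pcompose s s' = [:0, 1:]" and s's: "pcompose s' s = [:0, 1:]"
begin

definition x where "x = twisted_shift 1 s"
definition y where "y = twisted_shift (-1) s'"

lemma pcompose_inverse [simp]: "pcompose (pcompose p s) s' = p" "pcompose (pcompose p s') s = p"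
  by (simp_all add: ss' s's flip: pcompose_assoc)

lemma pcompose_s_nz: "p \<noteq> 0 \<Longrightarrow> pcompose p s \<noteq> 0" "p \<noteq> 0 \<Longrightarrow> pcompose p s' \<noteq> 0"
  using pcompose_inverse[of p] by (metis pcompose_0)+

lemma xy: "x * y = 1"
  by (simp add: x_def y_def times_opr.rep_eq one_opr.rep_eq twisted_shift.rep_eq fun_eq_iff
      flip: app_inject)

lemma yx: "y * x = 1"
  by (simp add: x_def y_def times_opr.rep_eq one_opr.rep_eq twisted_shift.rep_eq fun_eq_iff
      flip: app_inject)

lemma x_mulop: "x * mulop p = mulop (pcompose p s) * x"
  unfolding x_def by transfer (simp add: fun_eq_iff pcompose_mult)

lemma y_mulop: "y * mulop p = mulop (pcompose p s') * y"
  unfolding y_def by transfer (simp add: fun_eq_iff pcompose_mult)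

lemma xn_yn: "x ^ n * y ^ n = 1" "y ^ n * x ^ n = 1"
proof (induct n)
  case (Suc n)
  case 1
  have "x ^ Suc n * y ^ Suc n = x ^ n * (x * y) * y ^ n"
    by (simp only: power_Suc2[of x] power_Suc[of y] mult.assoc)
  then show ?case using Suc by (simp add: xy)
next
  case (Suc n)
  case 2
  have "y ^ Suc n * x ^ Suc n = y ^ n * (y * x) * x ^ n"
    by (simp only: power_Suc2[of y] power_Suc[of x] mult.assoc)
  then show ?case using Suc by (simp add: yx)
qed simp_all

lemma xn_cancel: "z * x ^ n = 0 \<Longrightarrow> z = 0" "x ^ n * z = 0 \<Longrightarrow> z = 0"
  using xn_yn[of n] by (metis mult.assoc mult_1_right mult_zero_left,
    metis mult.assoc mult_1_left mult_zero_right)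

definition twist :: "nat \<Rightarrow> 'k poly \<Rightarrow> 'k poly" where
  "twist n p = ((\<lambda>p. pcompose p s) ^^ n) p"

lemma xn_mulop: "x ^ n * mulop p = mulop (twist n p) * x ^ n"
proof (induct n arbitrary: p)
  case (Suc n)
  have "x ^ Suc n * mulop p = x * (x ^ n * mulop p)" by (simp add: mult.assoc)
  also have "\<dots> = (x * mulop (twist n p)) * x ^ n" by (simp add: Suc mult.assoc)
  finally show ?case by (simp add: x_mulop twist_def mult.assoc)
qed (simp add: twist_def)

lemma twist_0: "twist n 0 = 0"
  by (induct n) (simp_all add: twist_def)

lemma twist_nz: "p \<noteq> 0 \<Longrightarrow> twist n p \<noteq> 0"
  by (induct n) (auto simp: twist_def pcompose_s_nz)

lemma twist_surj: "\<exists>p. twist n p = q"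
proof (induct n arbitrary: q)
  case (Suc n)
  obtain p where "twist n p = pcompose q s'" using Suc by blast
  then have "twist (Suc n) p = q" by (simp add: twist_def)
  then show ?case by blast
qed (simp add: twist_def)

lemma cf_x: "cf (x ^ i) n = (if n = int i then 1 else 0)"
proof (induct i arbitrary: n)
  case (Suc i)
  have "cf (x ^ Suc i) n = pcompose (cf (x ^ i) (n - 1)) s"
    by (simp add: cf_def times_opr.rep_eq x_def twisted_shift.rep_eq)
  then show ?case by (auto simp: Suc pcompose_1)
qed (simp add: cf_def one_opr.rep_eq)

lemma cf_monom: "cf (mulop p * x ^ i) n = (if n = int i then p else 0)"
  by (simp add: cf_mulop cf_x)

section \<open>The skew polynomial ring \<open>k[h][x; \<sigma>]\<close>, filtered by degree:
  \<open>fil n\<close> holds the degrees below \<open>n\<close>\<close>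

primrec fil :: "nat \<Rightarrow> 'k opr set" where
  "fil 0 = {0}"
| "fil (Suc n) = {c + mulop p * x ^ n | c p. c \<in> fil n}"

declare fil.simps(2) [simp del]

lemma fil_SucE:
  assumes "z \<in> fil (Suc n)" obtains c p where "c \<in> fil n" "z = c + mulop p * x ^ n"
  using assms unfolding fil.simps by blast

lemma fil_SucI: "c \<in> fil n \<Longrightarrow> c + mulop p * x ^ n \<in> fil (Suc n)"
  unfolding fil.simps by blast

lemma fil_Suc: "c \<in> fil n \<Longrightarrow> c \<in> fil (Suc n)"
  using fil_SucI[of c n 0] by simp

lemma fil_mono: "c \<in> fil n \<Longrightarrow> n \<le> m \<Longrightarrow> c \<in> fil m"
  by (rotate_tac, induct m rule: dec_induct) (auto intro: fil_Suc)

lemma fil_0: "0 \<in> fil n"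
  using fil_mono[of 0 0 n] by simp

lemma fil_monom: "n < m \<Longrightarrow> mulop p * x ^ n \<in> fil m"
  using fil_SucI[OF fil_0[of n], of p] fil_mono[of _ "Suc n" m] by simp

lemma fil_add: "c \<in> fil n \<Longrightarrow> d \<in> fil n \<Longrightarrow> c + d \<in> fil n"
proof (induct n arbitrary: c d)
  case (Suc n)
  obtain c' p d' q where "c' \<in> fil n" "c = c' + mulop p * x ^ n" "d' \<in> fil n" "d = d' + mulop q * x ^ n"
    using Suc.prems by (metis fil_SucE)
  moreover from this have "c + d = (c' + d') + mulop (p + q) * x ^ n"
    by (simp add: mulop_add algebra_simps)
  ultimately show ?case using Suc.hyps fil_SucI by metis
qed simp

lemma fil_mulop: "c \<in> fil n \<Longrightarrow> mulop q * c \<in> fil n"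
proof (induct n arbitrary: c)
  case (Suc n)
  obtain c' p where c: "c' \<in> fil n" "c = c' + mulop p * x ^ n"
    using Suc.prems by (rule fil_SucE)
  have "mulop q * c = mulop q * c' + mulop (q * p) * x ^ n"
    by (simp add: c mulop_mult distrib_left mult.assoc)
  then show ?case using Suc.hyps[OF c(1)] fil_SucI by metis
qed simp

lemma fil_diff: "c \<in> fil n \<Longrightarrow> d \<in> fil n \<Longrightarrow> c - d \<in> fil n"
  using fil_add[of c n "mulop (-1) * d"] fil_mulop[of d n "-1"] by (simp add: mulop_minus_1)

lemma monom_mult_monom:
  "mulop p * x ^ k * (mulop q * x ^ l) = mulop (p * twist k q) * x ^ (k + l)"
proof -
  have "mulop p * x ^ k * (mulop q * x ^ l) = mulop p * (x ^ k * mulop q) * x ^ l"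
    by (simp add: mult.assoc)
  then show ?thesis by (simp add: xn_mulop mulop_mult power_add mult.assoc)
qed

lemma fil_mult_monom: "c \<in> fil n \<Longrightarrow> c * (mulop q * x ^ m) \<in> fil (n + m)"
proof (induct n arbitrary: c)
  case (Suc n)
  obtain c' p where c: "c' \<in> fil n" "c = c' + mulop p * x ^ n"
    using Suc.prems by (rule fil_SucE)
  have "c * (mulop q * x ^ m) = c' * (mulop q * x ^ m) + mulop (p * twist n q) * x ^ (n + m)"
    by (simp add: c distrib_right monom_mult_monom)
  then show ?case using fil_SucI[OF Suc.hyps[OF c(1)]] by (metis add_Suc)
qed (simp add: fil_0)

text \<open>The asymmetric bounds are sharp: degrees below \<open>n\<close> times degrees at most
  \<open>m\<close> stay below \<open>n + m\<close>, which keeps the lower terms of a product away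
  from its leading term.\<close>

lemma fil_mult: "c \<in> fil n \<Longrightarrow> d \<in> fil (Suc m) \<Longrightarrow> c * d \<in> fil (n + m)"
proof (induct m arbitrary: d)
  case 0
  then show ?case using fil_mult_monom[of c n _ 0] by (auto elim!: fil_SucE)
next
  case (Suc m)
  obtain d' q where d: "d' \<in> fil (Suc m)" "d = d' + mulop q * x ^ Suc m"
    using Suc.prems(2) by (rule fil_SucE)
  have "c * d' \<in> fil (n + Suc m)" using Suc d fil_Suc by simp
  moreover have "c * (mulop q * x ^ Suc m) \<in> fil (n + Suc m)" by (rule fil_mult_monom) fact
  ultimately show ?case unfolding d(2) distrib_left by (rule fil_add)
qed

lemma cf_fil: "c \<in> fil n \<Longrightarrow> k \<ge> int n \<Longrightarrow> cf c k = 0"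
proof (induct n arbitrary: c)
  case (Suc n)
  then show ?case by (auto elim!: fil_SucE simp: cf_add cf_monom)
qed simp

lemma fil_lead:
  assumes "c \<in> fil n" "c \<noteq> 0"
  obtains k c' p where "k < n" "c' \<in> fil k" "p \<noteq> 0" "c = c' + mulop p * x ^ k"
  using assms
proof (induct n arbitrary: c thesis)
  case (Suc n)
  obtain c' p where c: "c' \<in> fil n" "c = c' + mulop p * x ^ n"
    using Suc.prems by (metis fil_SucE)
  show ?case
  proof (cases "p = 0")
    case True
    then have "c = c'" using c by simp
    show thesis using Suc.hyps[of c] Suc.prems c unfolding \<open>c = c'\<close> by (metis less_SucI)
  next
    case False
    then show thesis using Suc.prems(1)[of n c' p] c by simp
  qed
qed simp

text \<open>The coefficient at the top degree \<open>k + l\<close> is \<open>p * twist k q\<close>,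
  nonzero since \<sigma> is injective and \<open>k[h]\<close> is a domain.\<close>

lemma fil_no_zero_div:
  assumes "c \<in> fil n" "d \<in> fil m" "c \<noteq> 0" "d \<noteq> 0"
  shows "c * d \<noteq> 0"
proof -
  obtain k c' p where c: "c' \<in> fil k" "p \<noteq> 0" "c = c' + mulop p * x ^ k"
    using fil_lead assms(1,3) by metis
  obtain l d' q where d: "d' \<in> fil l" "q \<noteq> 0" "d = d' + mulop q * x ^ l"
    using fil_lead assms(2,4) by metis
  have 1: "c' * d \<in> fil (k + l)" using c d fil_mult fil_SucI by blast
  have 2: "mulop p * x ^ k * d' \<in> fil (k + l)"
  \<comment> \<open>\<open>fil_mult\<close> expects its second factor in some
    \<open>fil (Suc l')\<close>; for \<open>l = 0\<close> the lower part \<open>d'\<close>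
    vanishes.\<close>
  proof (cases l)
    case (Suc l')
    have "mulop p * x ^ k \<in> fil (Suc k)" by (rule fil_monom) simp
    then show ?thesis using fil_mult[of _ "Suc k" d' l'] d Suc by simp
  qed (use d in \<open>simp add: fil_0\<close>)
  have "c * d = c' * d + mulop p * x ^ k * d' + mulop (p * twist k q) * x ^ (k + l)"
    unfolding monom_mult_monom[symmetric] unfolding c(3) by (simp add: d(3) algebra_simps)
  then have "cf (c * d) (int (k + l)) = p * twist k q"
    using cf_fil[OF fil_add[OF 1 2]] by (simp add: cf_add cf_monom)
  then show ?thesis using c d twist_nz by fastforce
qed

definition C :: "'k opr set" where
  "C = (\<Union>n. fil n)"

lemma C_I: "c \<in> fil n \<Longrightarrow> c \<in> C"
  unfolding C_def by (rule UN_I[of n]) simp_all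

lemma C_common:
  assumes "c \<in> C" "d \<in> C"
  obtains n where "c \<in> fil n" "d \<in> fil n"
proof -
  obtain n m where "c \<in> fil n" "d \<in> fil m" using assms unfolding C_def by blast
  then show ?thesis
    using that[of "max n m"] fil_mono[of c n "max n m"] fil_mono[of d m "max n m"] by simp
qed

lemma C_add: assumes "c \<in> C" "d \<in> C" shows "c + d \<in> C"
  by (rule C_common[OF assms]) (rule C_I[OF fil_add])

lemma C_mult: assumes "c \<in> C" "d \<in> C" shows "c * d \<in> C"
  by (rule C_common[OF assms]) (rule C_I[OF fil_mult[OF _ fil_Suc]])

lemma C_monom: "mulop p * x ^ n \<in> C"
  by (rule C_I[OF fil_monom[of n "Suc n"]]) simp

lemma C_mulop: "mulop p \<in> C"
  using C_monom[of p 0] by simp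

lemma C_x: "x ^ n \<in> C"
  using C_monom[of 1 n] by simp

lemma C_1: "1 \<in> C"
  using C_mulop[of 1] by simp

lemma C_no_zero_div: "c \<in> C \<Longrightarrow> d \<in> C \<Longrightarrow> c \<noteq> 0 \<Longrightarrow> d \<noteq> 0 \<Longrightarrow> c * d \<noteq> 0"
  by (erule (1) C_common) (rule fil_no_zero_div)

text \<open>Cross-multiplying with the leading coefficients cancels the leading term, so a common
  multiple is found by descent on the degrees in \<^term>\<open>x\<close>.\<close>

lemma fil_reduce:
  assumes "c \<in> fil k" "d \<in> fil l" "l \<le> k" "p \<noteq> 0" "q \<noteq> 0"
  shows "\<exists>u\<in>C. \<exists>v\<in>C. u \<noteq> 0 \<and> (c + mulop p * x ^ k) * u - (d + mulop q * x ^ l) * v \<in> fil k"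
proof -
  \<comment> \<open>\<open>r'\<close> and \<open>r\<close> undo the twists picked up in moving
    coefficients past \<open>x ^ k\<close> and \<open>x ^ l\<close>, so both leading coefficients
    become \<open>p * q\<close>.\<close>
  obtain r' where r': "twist k r' = q" using twist_surj by blast
  obtain r where r: "twist l r = p" using twist_surj by blast
  define u where "u = mulop r'"
  define v where "v = mulop r * x ^ (k - l)"
  have "r' \<noteq> 0" using r' assms(5) twist_0 by auto
  then have u: "u \<noteq> 0" using cf_monom[of r' 0 0] by (auto simp: u_def)
  have "mulop p * x ^ k * u = mulop (p * q) * x ^ k"
    using monom_mult_monom[of p k r' 0] r' by (simp add: u_def)
  moreover have "mulop q * x ^ l * v = mulop (p * q) * x ^ k"
    using monom_mult_monom[of q l r "k - l"] r assms(3) by (simp add: v_def mult.commute)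
  ultimately have "(c + mulop p * x ^ k) * u - (d + mulop q * x ^ l) * v = c * u - d * v"
    by (simp add: algebra_simps)
  moreover have "c * u \<in> fil k" using fil_mult_monom[OF assms(1), of r' 0] by (simp add: u_def)
  moreover have "d * v \<in> fil k"
    using fil_mult_monom[OF assms(2), of r "k - l"] assms(3) by (simp add: v_def)
  ultimately have "(c + mulop p * x ^ k) * u - (d + mulop q * x ^ l) * v \<in> fil k"
    using fil_diff by simp
  moreover have "u \<in> C" "v \<in> C" unfolding u_def v_def by (rule C_mulop C_monom)+
  ultimately show ?thesis using u by blast
qed

text \<open>Euclidean descent: the remainder \<open>e = c * u - d * v\<close> has smaller degree
  than \<open>c\<close>, and if \<open>e * w = d * z\<close>, then
  \<open>c * (u * w) = d * (z + v * w)\<close>.\<close>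

lemma fil_ore:
  assumes "c \<in> fil n" "d \<in> fil m" "c \<noteq> 0" "d \<noteq> 0"
  shows "\<exists>u\<in>C. \<exists>v\<in>C. c * u = d * v \<and> c * u \<noteq> 0"
  using assms
proof (induct "n + m" arbitrary: c d n m rule: less_induct)
  case less
  \<comment> \<open>Stated for arbitrary \<open>c\<close> and \<open>d\<close>, so that the roles
    can be exchanged when \<open>d\<close> has the larger degree.\<close>
  have step: "\<exists>u\<in>C. \<exists>v\<in>C. c * u = d * v \<and> c * u \<noteq> 0"
    if IH: "\<And>e. e \<in> fil k \<Longrightarrow> e \<noteq> 0 \<Longrightarrow> \<exists>u\<in>C. \<exists>v\<in>C. e * u = d * v \<and> e * u \<noteq> 0"
      and c: "c' \<in> fil k" "p \<noteq> 0" "c = c' + mulop p * x ^ k" "c \<noteq> 0" "c \<in> C"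
      and d: "d' \<in> fil l" "q \<noteq> 0" "d = d' + mulop q * x ^ l" and "l \<le> k"
    for c c' d d' :: "'k opr" and k l p q
  proof -
    obtain u v where uv: "u \<in> C" "v \<in> C" "u \<noteq> 0" "c * u - d * v \<in> fil k"
      using fil_reduce[OF c(1) d(1) \<open>l \<le> k\<close> c(2) d(2)] c d by blast
    show ?thesis
    proof (cases "c * u - d * v = 0")
      case True
      then show ?thesis using uv C_no_zero_div[OF c(5) uv(1) c(4) uv(3)] by auto
    next
      case False
      then obtain w z where wz: "w \<in> C" "z \<in> C" "(c * u - d * v) * w = d * z" "(c * u - d * v) * w \<noteq> 0"
        using IH uv by blast
      then have "w \<noteq> 0" by auto
      have "c * (u * w) = d * (z + v * w)" using wz(3) by (simp add: algebra_simps)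
      moreover have "u * w \<noteq> 0" using C_no_zero_div uv wz \<open>w \<noteq> 0\<close> by blast
      then have "c * (u * w) \<noteq> 0" using C_no_zero_div c C_mult uv wz by blast
      ultimately show ?thesis using C_mult C_add uv wz by blast
    qed
  qed
  obtain k c' p where c: "k < n" "c' \<in> fil k" "p \<noteq> 0" "c = c' + mulop p * x ^ k"
    using fil_lead less.prems(1,3) by metis
  obtain l d' q where d: "l < m" "d' \<in> fil l" "q \<noteq> 0" "d = d' + mulop q * x ^ l"
    using fil_lead less.prems(2,4) by metis
  have CC: "c \<in> C" "d \<in> C" using less.prems(1,2) by (simp_all add: C_I)
  show ?case
  proof (cases "l \<le> k")
    case True
    have "\<exists>u\<in>C. \<exists>v\<in>C. e * u = d * v \<and> e * u \<noteq> 0" if "e \<in> fil k" "e \<noteq> 0" for e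
      using less.hyps[of k m e d] less.prems that c by simp
    then show ?thesis
      using step[where k = k and d = d and c' = c' and p = p and c = c and d' = d' and q = q and l = l] c d less.prems CC True by blast
  next
    case False
    have "\<exists>u\<in>C. \<exists>v\<in>C. e * u = c * v \<and> e * u \<noteq> 0" if "e \<in> fil l" "e \<noteq> 0" for e
      using less.hyps[of l n e c] less.prems that d by simp
    then have "\<exists>u\<in>C. \<exists>v\<in>C. d * u = c * v \<and> d * u \<noteq> 0"
      using step[where k = l and d = c and c' = d' and p = q and c = d and d' = c' and q = p and l = k] c d less.prems CC False by simp
    then show ?thesis by metis
  qed
qed

lemma C_ore: "c \<in> C \<Longrightarrow> d \<in> C \<Longrightarrow> c \<noteq> 0 \<Longrightarrow> d \<noteq> 0 \<Longrightarrow> \<exists>u\<in>C. \<exists>v\<in>C. c * u = d * v \<and> c * u \<noteq> 0"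
  by (erule (1) C_common) (rule fil_ore)

section \<open>Localization at the powers of \<open>x\<close>\<close>

lemma fil_twist: "c \<in> fil n \<Longrightarrow> y * c * x \<in> fil n"
proof (induct n arbitrary: c)
  case (Suc n)
  obtain c' p where c: "c' \<in> fil n" "c = c' + mulop p * x ^ n"
    using Suc.prems by (rule fil_SucE)
  have "y * (mulop p * x ^ n) * x = (y * mulop p) * x * x ^ n"
    by (simp add: mult.assoc flip: power_Suc power_Suc2)
  also have "\<dots> = mulop (pcompose p s') * (y * x) * x ^ n"
    by (simp add: y_mulop mult.assoc)
  finally have "y * c * x = y * c' * x + mulop (pcompose p s') * x ^ n"
    by (simp add: c yx distrib_left distrib_right)
  then show ?case using Suc.hyps[OF c(1)] fil_SucI by metis
qed simp

lemma C_y_x: "c \<in> C \<Longrightarrow> y * c * x \<in> C"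
  unfolding C_def using fil_twist by blast

text \<open>Conjugation by \<open>x\<close> only applies the inverse of \<sigma> to the
  coefficients, so powers of \<open>x\<close> can be moved to the left of elements of
  \<open>C\<close>.\<close>

lemma C_twist: "c \<in> C \<Longrightarrow> \<exists>d\<in>C. c * x ^ n = x ^ n * d"
proof (induct n)
  case (Suc n)
  then obtain d where d: "d \<in> C" "c * x ^ n = x ^ n * d" by blast
  have "c * x ^ Suc n = x ^ n * d * x" using d by (simp add: power_Suc2 del: power_Suc flip: mult.assoc)
  also have "\<dots> = x ^ n * (x * y) * d * x" by (simp add: xy)
  also have "\<dots> = x ^ Suc n * (y * d * x)" by (simp only: power_Suc2 mult.assoc)
  finally show ?case using C_y_x[OF d(1)] by blast
qed auto

text \<open>\<open>S\<close> plays the role of the skew Laurent ring; in this form its closure under products is immediate.\<close>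

definition S :: "'k opr set" where
  "S = {z. \<forall>c\<in>C. \<exists>n. z * c * x ^ n \<in> C}"

lemma C_x_le: "z * x ^ n \<in> C \<Longrightarrow> n \<le> m \<Longrightarrow> z * x ^ m \<in> C"
  using C_mult[of "z * x ^ n" "x ^ (m - n)"] C_x[of "m - n"] by (simp add: mult.assoc flip: power_add)

lemma S_common: "z \<in> S \<Longrightarrow> w \<in> S \<Longrightarrow> c \<in> C \<Longrightarrow> d \<in> C \<Longrightarrow> \<exists>n. z * c * x ^ n \<in> C \<and> w * d * x ^ n \<in> C"
proof -
  assume "z \<in> S" "w \<in> S" "c \<in> C" "d \<in> C"
  then obtain n m where nm: "z * c * x ^ n \<in> C" "w * d * x ^ m \<in> C" unfolding S_def by blast
  show ?thesis
    using C_x_le[OF nm(1), of "max n m"] C_x_le[OF nm(2), of "max n m"]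
    by (intro exI[of _ "max n m"]) simp
qed

lemma S_x: "z \<in> S \<Longrightarrow> w \<in> S \<Longrightarrow> \<exists>n. z * x ^ n \<in> C \<and> w * x ^ n \<in> C"
  using S_common[OF _ _ C_1 C_1] by simp

lemma S_mult: 
  assumes "z \<in> S" "w \<in> S" shows "z * w \<in> S"
  unfolding S_def
proof safe
  fix c assume "c \<in> C"
  then obtain n where "w * c * x ^ n \<in> C" using assms S_def by blast
  then obtain m where "z * (w * c * x ^ n) * x ^ m \<in> C" using assms S_def by blast
  then show "\<exists>n. z * w * c * x ^ n \<in> C"
    by (intro exI[of _ "n + m"]) (simp add: power_add mult.assoc)
qed

lemma S_add:
  assumes "z \<in> S" "w \<in> S" shows "z + w \<in> S"
  unfolding S_def
proof safe
  fix c assume "c \<in> C"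
  then obtain n where "z * c * x ^ n \<in> C" "w * c * x ^ n \<in> C" using assms S_common by blast
  then show "\<exists>n. (z + w) * c * x ^ n \<in> C"
    by (intro exI[of _ n]) (simp add: distrib_right C_add)
qed

lemma C_S: "c \<in> C \<Longrightarrow> c \<in> S"
  unfolding S_def using C_mult by (auto intro!: exI[of _ 0])

lemma y_S: "y \<in> S"
  unfolding S_def using C_y_x by (auto intro!: exI[of _ 1])

sublocale ore_domain S
proof
  show "1 \<in> S" using C_S C_1 by blast
  show "a - b \<in> S" if "a \<in> S" "b \<in> S" for a b
    using S_add[OF that(1) S_mult[OF C_S[OF C_mulop[of "-1"]] that(2)]]
    by (simp add: mulop_minus_1)
  show "a * b \<in> S" if "a \<in> S" "b \<in> S" for a b using that by (rule S_mult)
  show "a = 0 \<or> b = 0" if ab: "a \<in> S" "b \<in> S" "a * b = 0" for a b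
  proof (rule ccontr)
    assume nz: "\<not> (a = 0 \<or> b = 0)"
    obtain n where n: "a * x ^ n \<in> C" "b * x ^ n \<in> C" using S_x ab by blast
    \<comment> \<open>Moving \<open>x ^ n\<close> to the left across \<open>b * x ^ n\<close> makes
      \<open>a * x ^ n * d\<close> a product inside \<open>C\<close>; it equals
      \<open>a * b * x ^ n * x ^ n\<close>.\<close>
    obtain d where d: "d \<in> C" "b * x ^ n * x ^ n = x ^ n * d" using C_twist[OF n(2)] by blast
    have "d \<noteq> 0" using d nz xn_cancel(1)[of b "n + n"] by (auto simp: power_add mult.assoc)
    then have "a * x ^ n * d \<noteq> 0" using C_no_zero_div n d nz xn_cancel(1) by blast
    moreover have "a * x ^ n * d = a * b * x ^ n * x ^ n" using d by (simp add: mult.assoc)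
    ultimately show False using ab by simp
  qed
  show "\<exists>u\<in>S. \<exists>v\<in>S. a * u = b * v \<and> a * u \<noteq> 0"
    if ab: "a \<in> S" "b \<in> S" "a \<noteq> 0" "b \<noteq> 0" for a b
  proof -
    obtain n where n: "a * x ^ n \<in> C" "b * x ^ n \<in> C" using S_x ab by blast
    then obtain u v where "u \<in> C" "v \<in> C" "a * x ^ n * u = b * x ^ n * v" "a * x ^ n * u \<noteq> 0"
      using C_ore xn_cancel(1) ab by blast
    then show ?thesis using C_S C_x S_mult
      by (intro bexI[of _ "x ^ n * u"] bexI[of _ "x ^ n * v"]) (auto simp: mult.assoc)
  qed
qed

end

section \<open>Free algebras and their quotients\<close>

lemma free_alg_simps [simp]:
  "carrier free_alg = UNIV" "mult free_alg = (*)" "add free_alg = (+)"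
  "one free_alg = 1" "zero free_alg = 0" "smult free_alg c f = scal c * f"
  by (simp_all add: free_alg_def type_alg_def)

lemma ring_free_alg: "ring free_alg"
  unfolding free_alg_def by (rule ring_type_alg)

lemma single_add_induct:
  assumes single: "\<And>w c. P (Poly_Mapping.single w c)" and add: "\<And>f g. P f \<Longrightarrow> P g \<Longrightarrow> P (f + g)"
  shows "P (f :: 'w \<Rightarrow>\<^sub>0 'k::ab_group_add)"
proof -
  have sum: "P (\<Sum>w\<in>A. Poly_Mapping.single w (Poly_Mapping.lookup f w))" if "finite A" for A
    using that
  proof induct
    case empty
    \<comment> \<open>The empty sum is a monomial with coefficient \<open>0\<close>; any word will
      do.\<close>
    show ?case using single[of undefined 0] by simp
  qed (simp add: single add)
  have "f = (\<Sum>w\<in>Poly_Mapping.keys f. Poly_Mapping.single w (Poly_Mapping.lookup f w))"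
    by (rule poly_mapping_eqI)
      (simp add: lookup_sum lookup_single when_def in_keys_iff)
  then show ?thesis using sum[OF finite_keys] by metis
qed

lemma plus_word: "Word u + Word v = Word (u @ v)"
  by (simp add: plus_word_def)

text \<open>Building words from the left reduces closure statements to left multiplication by one
  generator.\<close>

lemma free_alg_induct [case_names scal gen add]:
  assumes scal: "\<And>c. P (scal c)" and gen: "\<And>g f. P f \<Longrightarrow> P (gen g * f)"
    and add: "\<And>f g. P f \<Longrightarrow> P g \<Longrightarrow> P (f + g)"
  shows "P (f :: 'g word \<Rightarrow>\<^sub>0 'k::field)"
proof (induct f rule: single_add_induct)
  case (1 w c)
  have "P (Poly_Mapping.single (Word l) c)" for l
  proof (induct l)
    case Nil
    then show ?case using scal[of c] by (simp add: scal_def zero_word_def)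
  next
    case (Cons g l)
    then show ?case using gen[OF Cons, of g] by (simp add: gen_def mult_single plus_word)
  qed
  then show ?case by (metis word.exhaust)
qed (rule add)

lemma scal_0 [simp]: "scal 0 = 0"
  by (simp add: scal_def)

lemma scal_1 [simp]: "scal 1 = 1"
  by (simp add: scal_def)

lemma scal_add: "scal (c + d) = scal c + scal d"
  by (simp add: scal_def single_add)

lemma scal_mult: "scal (c * d) = scal c * scal d"
  by (simp add: scal_def mult_single)

lemma scal_commute: "scal c * f = f * scal c"
proof (induct f rule: single_add_induct)
  case (1 w d)
  then show ?case by (simp add: scal_def mult_single mult.commute)
next
  case (2 f g)
  then show ?case by (simp add: distrib_left distrib_right)
qed

lemma scal_left_commute: "f * (scal c * g) = scal c * (f * g)"
  by (simp only: mult.assoc[symmetric] scal_commute[of c f])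

text \<open>The base point \<open>H\<close> is arbitrary because in the algebras on
  \<open>x, y\<close> the element in the role of \<open>h\<close> is not a generator.\<close>

definition ev :: "('g word \<Rightarrow>\<^sub>0 'k::field) \<Rightarrow> 'k poly \<Rightarrow> ('g word \<Rightarrow>\<^sub>0 'k)" where
  "ev H p = (\<Sum>i\<le>degree p. scal (coeff p i) * H ^ i)"

lemma at_H_ev: "at_H = ev (gen Hgen)"
  by (simp add: fun_eq_iff at_H_def ev_def)

lemma ev_0 [simp]: "ev H 0 = 0"
  by (simp add: ev_def)

lemma ev_pCons: "ev H (pCons c p) = scal c + H * ev H p"
proof (cases "p = 0")
  case True
  then show ?thesis by (simp add: ev_def)
next
  case False
  then show ?thesis
    by (simp add: ev_def sum.atMost_Suc_shift sum_distrib_left scal_left_commute del: sum.atMost_Suc)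
qed

lemma ev_const: "ev H [:c:] = scal c"
  by (simp add: ev_pCons)

lemma ev_X: "ev H [:0, 1:] = H"
  by (simp add: ev_pCons)

lemma ev_add: "ev H (p + q) = ev H p + ev H q"
proof (induct p q rule: poly_induct2)
  case (pCons a p b q)
  then show ?case by (simp add: ev_pCons scal_add algebra_simps)
qed simp

lemma ev_smult: "ev H (Polynomial.smult c p) = scal c * ev H p"
proof (induct p)
  case (pCons a p)
  then show ?case by (simp add: ev_pCons scal_mult distrib_left scal_left_commute)
qed simp

lemma ev_mult: "ev H (p * q) = ev H p * ev H q"
proof (induct p)
  case (pCons a p)
  then show ?case by (simp add: ev_pCons ev_add ev_smult distrib_right mult.assoc)
qed simp

text \<open>The universal property of the free algebra; centrality of the scalars is required
  against the images of the generators only.\<close>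

locale free_hom =
  fixes \<kappa> :: "'k::field \<Rightarrow> 'e::ring_1" and \<theta> :: "'g \<Rightarrow> 'e"
  assumes \<kappa>_0: "\<kappa> 0 = 0" and \<kappa>_1: "\<kappa> 1 = 1"
    and \<kappa>_add: "\<kappa> (c + d) = \<kappa> c + \<kappa> d" and \<kappa>_mult: "\<kappa> (c * d) = \<kappa> c * \<kappa> d"
    and \<kappa>_commute: "\<kappa> c * \<theta> g = \<theta> g * \<kappa> c"
begin

definition lift :: "('g word \<Rightarrow>\<^sub>0 'k) \<Rightarrow> 'e" where
  "lift f = (\<Sum>w\<in>Poly_Mapping.keys f. \<kappa> (Poly_Mapping.lookup f w) * prod_list (map \<theta> (letters w)))"

lemma lift_add: "lift (f + g) = lift f + lift g"
  unfolding lift_def by (rule setsum_keys_plus_distrib) (simp_all add: \<kappa>_0 \<kappa>_add distrib_right)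

lemma lift_single: "lift (Poly_Mapping.single w c) = \<kappa> c * prod_list (map \<theta> (letters w))"
  by (simp add: lift_def \<kappa>_0)

lemma lift_0: "lift 0 = 0"
  by (simp add: lift_def)

lemma lift_scal: "lift (scal c) = \<kappa> c"
  by (simp add: scal_def lift_single zero_word_def)

lemma lift_gen: "lift (gen g) = \<theta> g"
  by (simp add: gen_def lift_single \<kappa>_1)

lemma lift_1: "lift 1 = 1"
  using lift_scal[of 1] \<kappa>_1 by simp

lemma lift_mult: "lift (f * h) = lift f * lift h"
proof (induct f rule: free_alg_induct)
  case (scal c)
  show ?case unfolding lift_scal
  proof (induct h rule: single_add_induct)
    case (1 w d)
    then show ?case by (simp add: scal_def mult_single lift_single \<kappa>_mult mult.assoc)
  qed (simp add: lift_add distrib_left)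
next
  case (gen g f)
  have *: "lift (gen g * h) = \<theta> g * lift h" for h
  proof (induct h rule: single_add_induct)
    case (1 w d)
    have "\<kappa> d * (\<theta> g * z) = \<theta> g * (\<kappa> d * z)" for z
      by (metis mult.assoc \<kappa>_commute)
    then show ?case by (simp add: gen_def mult_single lift_single plus_word_def)
  qed (simp add: lift_add distrib_left)
  show ?case using gen by (simp add: * mult.assoc)
qed (simp add: lift_add distrib_right)

lemma lift_diff: "lift (f - g) = lift f - lift g"
  using lift_add[of "f - g" g] by (simp add: algebra_simps)

lemma lift_power: "lift (f ^ n) = lift f ^ n"
  by (induct n) (simp_all add: lift_1 lift_mult)

lemma kernel_ideal: "ideal {f. lift f = 0} free_alg"
proof (rule idealI[OF ring_free_alg])
  show "subgroup {f. lift f = 0} (add_monoid free_alg)"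
  proof
    fix f assume f: "f \<in> {f. lift f = 0}"
    have "inv\<^bsub>add_monoid free_alg\<^esub> f = - f"
      using ring.ring_simprules(3) abelian_group.minus_equality[of free_alg "- f" f]
        ring.is_abelian_group[OF ring_free_alg] by (simp add: a_inv_def)
    then show "inv\<^bsub>add_monoid free_alg\<^esub> f \<in> {f. lift f = 0}"
      using f lift_diff[of 0 f] lift_0 by simp
  qed (auto simp: lift_add lift_0)
qed (auto simp: lift_mult)

lemma lift_Idl:
  assumes "\<And>r. r \<in> rels \<Longrightarrow> lift r = 0" "f \<in> Idl\<^bsub>free_alg\<^esub> rels"
  shows "lift f = 0"
  using ring.genideal_minimal[OF ring_free_alg kernel_ideal, of rels] assms by auto

end

section \<open>Congruence and cosets modulo a two-sided ideal\<close>

locale free_ideal =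
  fixes I :: "('g word \<Rightarrow>\<^sub>0 'k::field) set"
  assumes ideal_I: "ideal I free_alg"
begin

definition cong (infix "\<approx>" 50) where "f \<approx> g \<longleftrightarrow> f - g \<in> I"

lemma I_0: "0 \<in> I"
  using additive_subgroup.zero_closed[OF ideal.axioms(1)[OF ideal_I]] by simp

lemma I_add: "f \<in> I \<Longrightarrow> g \<in> I \<Longrightarrow> f + g \<in> I"
  using additive_subgroup.a_closed[OF ideal.axioms(1)[OF ideal_I]] by simp

lemma I_left: "f \<in> I \<Longrightarrow> g * f \<in> I"
  using ideal.I_l_closed[OF ideal_I] by simp

lemma I_right: "f \<in> I \<Longrightarrow> f * g \<in> I"
  using ideal.I_r_closed[OF ideal_I] by simp

lemma I_minus: "f \<in> I \<Longrightarrow> - f \<in> I"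
  using I_left[of f "- 1"] by simp

lemma cong_refl: "f \<approx> f"
  by (simp add: cong_def I_0)

lemma cong_sym: "f \<approx> g \<Longrightarrow> g \<approx> f"
  using I_minus[of "f - g"] by (simp add: cong_def)

lemma cong_trans [trans]: "f \<approx> g \<Longrightarrow> g \<approx> h \<Longrightarrow> f \<approx> h"
  using I_add[of "f - g" "g - h"] by (simp add: cong_def)

lemma cong_add: "f \<approx> g \<Longrightarrow> f' \<approx> g' \<Longrightarrow> f + f' \<approx> g + g'"
  using I_add[of "f - g" "f' - g'"] by (simp add: cong_def algebra_simps)

lemma cong_left: "f \<approx> g \<Longrightarrow> h * f \<approx> h * g"
  using I_left[of "f - g" h] by (simp add: cong_def algebra_simps)

lemma cong_right: "f \<approx> g \<Longrightarrow> f * h \<approx> g * h"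
  using I_right[of "f - g" h] by (simp add: cong_def algebra_simps)

definition coset :: "('g word \<Rightarrow>\<^sub>0 'k) \<Rightarrow> ('g word \<Rightarrow>\<^sub>0 'k) set" where
  "coset f = I +>\<^bsub>free_alg\<^esub> f"

lemma mem_coset: "g \<in> coset f \<longleftrightarrow> g \<approx> f"
  unfolding coset_def a_r_coset_def' cong_def by (auto simp: algebra_simps) (metis add_diff_cancel diff_add_cancel)

lemma coset_eq: "coset f = coset g \<longleftrightarrow> f \<approx> g"
  using mem_coset cong_refl cong_sym cong_trans by blast

lemma quot_carrier: "carrier (quot_alg free_alg I) = range coset"
  by (auto simp: quot_alg_def FactRing_def A_RCOSETS_def' coset_def)

lemma quot_one: "one (quot_alg free_alg I) = coset 1"
  by (simp add: quot_alg_def FactRing_def coset_def)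

lemma quot_zero: "zero (quot_alg free_alg I) = coset 0"
  by (simp add: quot_alg_def FactRing_def coset_def a_r_coset_def')

lemma quot_mult: "mult (quot_alg free_alg I) (coset f) (coset g) = coset (f * g)"
  using ideal.rcoset_mult_add[OF ideal_I, of f g] by (simp add: quot_alg_def FactRing_def coset_def)

lemma quot_add: "add (quot_alg free_alg I) (coset f) (coset g) = coset (f + g)"
  using abelian_subgroup.a_rcos_sum[OF abelian_subgroupI3[OF ideal.axioms(1)[OF ideal_I]
    ring.is_abelian_group[OF ring_free_alg]], of f g]
  by (simp add: quot_alg_def FactRing_def coset_def)

lemma quot_smult: "smult (quot_alg free_alg I) c (coset f) = coset (scal c * f)"
proof -
  have "smult (quot_alg free_alg I) c (coset f) = (\<Union>g\<in>coset f. coset (scal c * g))"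
    by (simp add: quot_alg_def coset_def)
  also have "\<dots> = coset (scal c * f)"
    using coset_eq mem_coset cong_left cong_refl by blast
  finally show ?thesis .
qed

end

section \<open>Embedding generalized Weyl algebras\<close>

lemma (in free_hom) lift_ev:
  assumes "lift H = \<eta> [:0, 1:]" "\<And>c. \<kappa> c = \<eta> [:c:]"
    and "\<And>p q. \<eta> (p + q) = \<eta> p + \<eta> q" "\<And>p q. \<eta> (p * q) = \<eta> p * \<eta> q"
  shows "lift (ev H p) = \<eta> p"
proof (induct p)
  case 0
  show ?case using assms(2)[of 0] by (simp add: lift_0 \<kappa>_0)
next
  case (pCons c p)
  have "\<eta> (pCons c p) = \<eta> ([:c:] + [:0, 1:] * p)" by simp
  also have "\<dots> = \<kappa> c + lift H * \<eta> p" by (simp only: assms)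
  finally show ?case using pCons by (simp add: ev_pCons lift_add lift_mult lift_scal)
qed

definition scal_opr :: "'k::comm_ring_1 \<Rightarrow> 'k opr" where
  "scal_opr c = mulop [:c:]"

lemma scal_opr_hom:
  "scal_opr 0 = 0" "scal_opr 1 = 1" "scal_opr (c + d) = scal_opr c + scal_opr d"
  "scal_opr (c * d) = scal_opr c * scal_opr d"
  by (simp_all add: scal_opr_def pCons_one mult.commute[of d] flip: mulop_add mulop_mult)

context skew_laurent
begin

lemma scal_opr_commute:
  "scal_opr c * mulop p = mulop p * scal_opr c" "scal_opr c * x = x * scal_opr c"
  "scal_opr c * y = y * scal_opr c"
  by (simp_all add: scal_opr_def x_mulop y_mulop mult.commute[of p] flip: mulop_mult)

end

text \<open>\<open>H\<close>, \<open>U\<close>, \<open>V\<close> represent \<open>h\<close>,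
  \<open>X^+\<close>, \<open>X^-\<close> in the free algebra and need not all be generators, so one
  locale covers the generalized Weyl algebras and the algebras on \<open>x, y\<close>. The relation
  for \<open>V\<close> is stated at \<open>\<sigma>(d)\<close>, which avoids the inverse of
  \<sigma>.\<close>

locale gwa_presentation = skew_laurent s s' + free_hom scal_opr \<theta>
  for s s' :: "'k::field poly" and \<theta> :: "'g \<Rightarrow> 'k opr" +
  fixes rels :: "('g word \<Rightarrow>\<^sub>0 'k) set" and H U V :: "'g word \<Rightarrow>\<^sub>0 'k" and a :: "'k poly"
  assumes a_nz: "a \<noteq> 0"
    and lift_rels: "r \<in> rels \<Longrightarrow> lift r = 0"
    and lift_H: "lift H = mulop [:0, 1:]" and lift_U: "lift U = x" and lift_V: "lift V = mulop a * y"
    and gen_mem: "gen g \<in> {H, U, V}"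
    and U_ev: "U * ev H d - ev H (pcompose d s) * U \<in> Idl\<^bsub>free_alg\<^esub> rels"
    and V_ev: "V * ev H (pcompose d s) - ev H d * V \<in> Idl\<^bsub>free_alg\<^esub> rels"
    and V_U: "V * U - ev H a \<in> Idl\<^bsub>free_alg\<^esub> rels"
    and U_V: "U * V - ev H (pcompose a s) \<in> Idl\<^bsub>free_alg\<^esub> rels"
begin

sublocale free_ideal "Idl\<^bsub>free_alg\<^esub> rels"
  by (rule free_ideal.intro, rule ring.genideal_ideal[OF ring_free_alg]) simp

abbreviation cong_rels (infix "\<approx>" 50) where
  "f \<approx> g \<equiv> free_ideal.cong (Idl\<^bsub>free_alg\<^esub> rels) f g"

abbreviation e where "e \<equiv> ev H"

lemma lift_e: "lift (e p) = mulop p"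
  by (rule lift_ev) (simp_all add: lift_H scal_opr_def mulop_add mulop_mult)

lemma cong_lift: "f \<approx> g \<Longrightarrow> lift f = lift g"
  using lift_Idl[of rels "f - g"] lift_rels by (simp add: cong_def lift_diff)

section \<open>Normal forms modulo the relations: sums of \<open>e p * U ^ i\<close> and
  \<open>e q * V ^ i\<close>\<close>

primrec nf :: "nat \<Rightarrow> ('g word \<Rightarrow>\<^sub>0 'k) set" where
  "nf 0 = {f. \<exists>p. f \<approx> e p}"
| "nf (Suc n) = {f. \<exists>g\<in>nf n. \<exists>p q. f \<approx> g + e p * U ^ Suc n + e q * V ^ Suc n}"

declare nf.simps [simp del]

lemma nf_0E: "f \<in> nf 0 \<Longrightarrow> (\<And>p. f \<approx> e p \<Longrightarrow> thesis) \<Longrightarrow> thesis"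
  unfolding nf.simps by blast

lemma nf_SucE:
  assumes "f \<in> nf (Suc n)"
  obtains g p q where "g \<in> nf n" "f \<approx> g + e p * U ^ Suc n + e q * V ^ Suc n"
  using assms unfolding nf.simps by blast

lemma nf_0I: "f \<approx> e p \<Longrightarrow> f \<in> nf 0"
  unfolding nf.simps by blast

lemma nf_SucI: "g \<in> nf n \<Longrightarrow> f \<approx> g + e p * U ^ Suc n + e q * V ^ Suc n \<Longrightarrow> f \<in> nf (Suc n)"
  unfolding nf.simps by blast

lemma nf_cong: "f \<in> nf n \<Longrightarrow> g \<approx> f \<Longrightarrow> g \<in> nf n"
  by (cases n) (auto simp: nf.simps intro: cong_trans)

lemma nf_Suc: "f \<in> nf n \<Longrightarrow> f \<in> nf (Suc n)"
  by (rule nf_SucI[of f n f 0 0]) (simp_all add: cong_refl)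

lemma nf_mono: "f \<in> nf n \<Longrightarrow> n \<le> m \<Longrightarrow> f \<in> nf m"
  by (rotate_tac, induct m rule: dec_induct) (auto intro: nf_Suc)

lemma nf_zero: "0 \<in> nf n"
  using nf_mono[OF nf_0I[of 0 0], of n] by (simp add: cong_refl)

lemma nf_U: "e p * U ^ n \<in> nf n"
proof (cases n)
  case 0
  then show ?thesis using nf_0I[OF cong_refl] by simp
next
  case (Suc m)
  show ?thesis unfolding Suc
    by (rule nf_SucI[OF nf_zero, of _ p m 0]) (simp add: cong_refl)
qed

lemma nf_V: "e p * V ^ n \<in> nf n"
proof (cases n)
  case 0
  then show ?thesis using nf_0I[OF cong_refl] by simp
next
  case (Suc m)
  show ?thesis unfolding Suc
    by (rule nf_SucI[OF nf_zero, of _ 0 m p]) (simp add: cong_refl)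
qed

lemma nf_add: "f \<in> nf n \<Longrightarrow> g \<in> nf n \<Longrightarrow> f + g \<in> nf n"
proof (induct n arbitrary: f g)
  case 0
  obtain p q where "f \<approx> e p" "g \<approx> e q" using 0 by (metis nf_0E)
  from cong_add[OF this] show ?case by (intro nf_0I[of _ "p + q"]) (simp add: ev_add)
next
  case (Suc n)
  obtain f' p q where f: "f' \<in> nf n" "f \<approx> f' + e p * U ^ Suc n + e q * V ^ Suc n"
    using Suc.prems(1) by (rule nf_SucE)
  obtain g' p' q' where g: "g' \<in> nf n" "g \<approx> g' + e p' * U ^ Suc n + e q' * V ^ Suc n"
    using Suc.prems(2) by (rule nf_SucE)
  have "f + g \<approx> (f' + g') + e (p + p') * U ^ Suc n + e (q + q') * V ^ Suc n"
    using cong_add[OF f(2) g(2)] by (simp add: ev_add distrib_right add_ac)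
  then show ?case by (rule nf_SucI[OF Suc.hyps[OF f(1) g(1)]])
qed

definition N where "N = (\<Union>n. nf n)"

lemma N_I: "f \<in> nf n \<Longrightarrow> f \<in> N"
  unfolding N_def by blast

lemma N_cong: "f \<in> N \<Longrightarrow> g \<approx> f \<Longrightarrow> g \<in> N"
  unfolding N_def using nf_cong by blast

lemma N_add: 
  assumes "f \<in> N" "g \<in> N" shows "f + g \<in> N"
proof -
  obtain n m where "f \<in> nf n" "g \<in> nf m" using assms unfolding N_def by blast
  then show ?thesis
    by (intro N_I[of _ "max n m"] nf_add) (auto elim: nf_mono)
qed

lemma N_left:
  assumes U: "\<And>p n. z * (e p * U ^ n) \<in> N" and V: "\<And>p n. z * (e p * V ^ n) \<in> N"
    and f: "f \<in> N"
  shows "z * f \<in> N"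
proof -
  have "z * f \<in> N" if "f \<in> nf n" for n f
    using that
  proof (induct n arbitrary: f)
    case 0
    then obtain p where "f \<approx> e p" by (rule nf_0E)
    then show ?case using U[of p 0] N_cong[OF _ cong_left] by (metis mult_1_right power_0)
  next
    case (Suc n)
    obtain g p q where g: "g \<in> nf n" "f \<approx> g + e p * U ^ Suc n + e q * V ^ Suc n"
      using Suc.prems by (rule nf_SucE)
    have "z * g + z * (e p * U ^ Suc n) + z * (e q * V ^ Suc n) \<in> N"
      by (rule N_add N_add Suc.hyps g U V)+
    then have "z * (g + e p * U ^ Suc n + e q * V ^ Suc n) \<in> N"
      by (simp only: distrib_left)
    then show ?case using N_cong cong_left[OF g(2)] by blast
  qed
  then show ?thesis using f unfolding N_def by blast
qed

lemma N_U: "e p * U ^ n \<in> N"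
  by (rule N_I[OF nf_U])

lemma N_V: "e p * V ^ n \<in> N"
  by (rule N_I[OF nf_V])

lemma N_left_e: "f \<in> N \<Longrightarrow> e q * f \<in> N"
  by (rule N_left) (simp_all only: mult.assoc[symmetric] ev_mult[symmetric] N_U N_V)

lemma pcompose_sE: obtains p' where "p = pcompose p' s"
  using pcompose_inverse(2)[of p] by metis

lemma N_left_U: "f \<in> N \<Longrightarrow> U * f \<in> N"
proof (rule N_left)
  have *: "U * (e p * f) \<approx> e (pcompose p s) * (U * f)" for p f
    using cong_right[of "U * e p" "e (pcompose p s) * U" f] U_ev
    by (simp add: cong_def mult.assoc)
  show "U * (e p * U ^ n) \<in> N" for p n
    by (rule N_cong[OF _ *]) (use N_U[of _ "Suc n"] in simp)
  show "U * (e p * V ^ n) \<in> N" for p n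
  proof (cases n)
    case 0
    show ?thesis by (rule N_cong[OF _ *]) (use N_U[of _ 1] 0 in simp)
  next
    case (Suc m)
    \<comment> \<open>A mixed product \<open>U * V\<close> collapses to a polynomial in
      \<open>H\<close>, lowering the power of \<open>V\<close>.\<close>
    have "U * V ^ n \<approx> e (pcompose a s) * V ^ m"
      using cong_right[of "U * V" "e (pcompose a s)" "V ^ m"] U_V Suc by (simp add: cong_def mult.assoc)
    then show ?thesis
      by (intro N_cong[OF _ *] N_left_e) (rule N_cong[OF N_V])
  qed
qed

text \<open>As \<open>V\<close> can be moved past values of \<sigma>, every coefficient is first
  written as some \<open>pcompose p' s\<close>.\<close>

lemma N_left_V: "f \<in> N \<Longrightarrow> V * f \<in> N"
proof (rule N_left)
  have *: "V * (e (pcompose p s) * f) \<approx> e p * (V * f)" for p f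
    using cong_right[of "V * e (pcompose p s)" "e p * V" f] V_ev
    by (simp add: cong_def mult.assoc)
  show "V * (e p * V ^ n) \<in> N" for p n
    by (rule pcompose_sE[of p], simp only:, rule N_cong[OF _ *]) (use N_V[of _ "Suc n"] in simp)
  show "V * (e p * U ^ n) \<in> N" for p n
  proof (cases n)
    case 0
    show ?thesis
      by (rule pcompose_sE[of p], simp only:, rule N_cong[OF _ *]) (use N_V[of _ 1] 0 in simp)
  next
    case (Suc m)
    have "V * U ^ n \<approx> e a * U ^ m"
      using cong_right[of "V * U" "e a" "U ^ m"] V_U Suc by (simp add: cong_def mult.assoc)
    then have "e p' * (V * U ^ n) \<in> N" for p'
      by (intro N_left_e) (rule N_cong[OF N_U])
    then show ?thesis
      by (rule_tac pcompose_sE[of p], simp only:, rule_tac N_cong[OF _ *])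
  qed
qed

text \<open>Normal forms contain the scalars and are stable under sums and left multiplication by
  \<open>H\<close>, \<open>U\<close> and \<open>V\<close>, hence exhaust the free algebra up to
  congruence.\<close>

lemma N_all: "f \<in> N"
proof (induct f rule: free_alg_induct)
  case (scal c)
  show ?case using N_U[of "[:c:]" 0] by (simp add: ev_const)
next
  case (gen g f)
  have "H * f \<in> N" using N_left_e[OF gen, of "[:0, 1:]"] by (simp add: ev_X)
  then show ?case using gen_mem[of g] N_left_U N_left_V gen by auto
qed (rule N_add)

text \<open>Moving the factors \<open>y\<close> to the right gives \<open>(a y)^n = A y^n\<close>,
  with \<open>A\<close> the product of \<open>\<sigma>^-i(a)\<close> over \<open>i < n\<close>; it
  is nonzero as \<open>a\<close> is.\<close>

lemma cf_V: "\<exists>A. A \<noteq> 0 \<and> (\<forall>k. cf ((mulop a * y) ^ n) k = (if k = - int n then A else 0))"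
proof (induct n)
  case 0
  show ?case using cf_x[of 0] by (intro exI[of _ 1]) simp
next
  case (Suc n)
  then obtain A where A: "A \<noteq> 0" "cf ((mulop a * y) ^ n) k = (if k = - int n then A else 0)" for k
    by blast
  have cf_y: "cf (y * z) k = pcompose (cf z (k + 1)) s'" for z k
    by (simp add: cf_def times_opr.rep_eq y_def twisted_shift.rep_eq)
  have "cf ((mulop a * y) ^ Suc n) k = a * pcompose (cf ((mulop a * y) ^ n) (k + 1)) s'" for k
    by (simp add: cf_mulop cf_y mult.assoc)
  then show ?case using A a_nz pcompose_s_nz(2)
    by (intro exI[of _ "a * pcompose A s'"]) auto
qed

lemma lift_U_monom: "lift (e p * U ^ n) = mulop p * x ^ n"
  by (simp add: lift_mult lift_power lift_e lift_U)

lemma lift_V_monom: "lift (e p * V ^ n) = mulop p * (mulop a * y) ^ n"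
  by (simp add: lift_mult lift_power lift_e lift_V)

section \<open>Injectivity of \<open>lift\<close> modulo the relations\<close>

lemma cf_nf: "f \<in> nf n \<Longrightarrow> \<bar>k\<bar> > int n \<Longrightarrow> cf (lift f) k = 0"
proof (induct n arbitrary: f)
  case 0
  obtain p where "f \<approx> e p" using 0 by (metis nf_0E)
  then have "lift f = mulop p * x ^ 0" using cong_lift by (simp add: lift_e)
  then show ?case using 0 by (simp only: cf_monom) simp
next
  case (Suc n)
  obtain g p q where g: "g \<in> nf n" "f \<approx> g + e p * U ^ Suc n + e q * V ^ Suc n"
    using Suc.prems(1) by (rule nf_SucE)
  obtain A where A: "cf ((mulop a * y) ^ Suc n) k = (if k = - int (Suc n) then A else 0)"
    using cf_V by blast
  have "cf (lift f) k = cf (lift g) k + cf (mulop p * x ^ Suc n) k + q * cf ((mulop a * y) ^ Suc n) k"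
    unfolding cong_lift[OF g(2)] lift_add lift_U_monom lift_V_monom cf_add cf_mulop ..
  then show ?case unfolding cf_monom A using Suc.hyps[OF g(1)] Suc.prems(2) by auto
qed

text \<open>The two top monomials are the only ones to reach the coefficients at
  \<open>n + 1\<close> and \<open>- (n + 1)\<close>, so \<open>p\<close> and \<open>q\<close> vanish
  one level at a time.\<close>

lemma nf_kernel: "f \<in> nf n \<Longrightarrow> lift f = 0 \<Longrightarrow> f \<approx> 0"
proof (induct n arbitrary: f)
  case 0
  obtain p where p: "f \<approx> e p" using 0 by (metis nf_0E)
  then have "mulop p * x ^ 0 = 0" using cong_lift 0 by (simp add: lift_e)
  then have "p = 0" using cf_monom[of p 0 0] by simp
  then show ?case using p by simp
next
  case (Suc n)
  obtain g p q where g: "g \<in> nf n" "f \<approx> g + e p * U ^ Suc n + e q * V ^ Suc n"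
    using Suc.prems(1) by (rule nf_SucE)
  obtain A where A: "A \<noteq> 0" "cf ((mulop a * y) ^ Suc n) k = (if k = - int (Suc n) then A else 0)" for k
    using cf_V by blast
  have cf: "0 = cf (lift g) k + cf (mulop p * x ^ Suc n) k + q * cf ((mulop a * y) ^ Suc n) k" for k
    unfolding cf_0[symmetric, of k] unfolding Suc.prems(2)[symmetric]
    unfolding cong_lift[OF g(2)] lift_add lift_U_monom lift_V_monom cf_add cf_mulop ..
  have "p = 0" using cf[of "int (Suc n)"] unfolding cf_monom A(2) using cf_nf[OF g(1)] by simp
  moreover have "q = 0"
    using cf[of "- int (Suc n)"] unfolding cf_monom A(2) using cf_nf[OF g(1)] A(1) by simp
  ultimately have fg: "f \<approx> g" using g(2) by simp
  then have "lift g = 0" using cong_lift Suc.prems(2) by simp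
  then show ?case using Suc.hyps[OF g(1)] fg cong_trans by blast
qed

lemma lift_eq_iff: "lift f = lift g \<longleftrightarrow> f \<approx> g"
proof
  assume "lift f = lift g"
  then have "lift (f - g) = 0" by (simp add: lift_diff)
  moreover obtain n where "f - g \<in> nf n" using N_all unfolding N_def by blast
  ultimately show "f \<approx> g" using nf_kernel[of "f - g"] by (simp add: cong_def)
qed (rule cong_lift)

lemma lift_S: "lift f \<in> S"
proof (induct f rule: free_alg_induct)
  case (scal c)
  show ?case unfolding lift_scal unfolding scal_opr_def by (rule C_S[OF C_mulop])
next
  case (gen g f)
  have "lift (gen g) \<in> S"
    using gen_mem[of g] lift_H lift_U lift_V C_S[OF C_mulop] C_S[OF C_x[of 1]] S_mult y_S by auto
  then show ?case using gen by (simp add: lift_mult S_mult)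
next
  case (add f g)
  then show ?case by (simp add: lift_add S_add)
qed

text \<open>The monomials \<open>e p * U ^ n\<close> alone already produce all skew
  polynomials.\<close>

lemma C_range_lift: "c \<in> C \<Longrightarrow> c \<in> range lift"
proof -
  have "c \<in> range lift" if "c \<in> fil n" for n
    using that
  proof (induct n arbitrary: c)
    case 0
    then show ?case using lift_0 by (metis fil.simps(1) rangeI singletonD)
  next
    case (Suc n)
    obtain c' p where c: "c' \<in> fil n" "c = c' + mulop p * x ^ n"
      using Suc.prems by (rule fil_SucE)
    obtain f where "c' = lift f" using Suc.hyps[OF c(1)] by blast
    then have "c = lift (f + e p * U ^ n)" using c by (simp add: lift_add lift_U_monom)
    then show ?case by blast
  qed
  then show "c \<in> C \<Longrightarrow> c \<in> range lift" unfolding C_def by blast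
qed

section \<open>Embedding of the presented algebra into \<open>S\<close>\<close>

definition embed :: "('g word \<Rightarrow>\<^sub>0 'k) set \<Rightarrow> 'k opr" where
  "embed X = the_elem (lift ` X)"

lemma embed_coset: "embed (coset f) = lift f"
proof -
  have "lift ` coset f = {lift f}"
    using cong_lift cong_refl by (auto simp: mem_coset intro!: image_eqI[of _ _ f])
  then show ?thesis by (simp add: embed_def)
qed

sublocale frac_embedding S "presented_alg rels" scal_opr embed
proof
  note quot = quot_carrier quot_one quot_zero quot_mult quot_add quot_smult
  show "inj_on embed (carrier (presented_alg rels))"
    unfolding presented_alg_def quot
    by (rule inj_onI, elim imageE) (simp add: embed_coset lift_eq_iff coset_eq)
  show "\<exists>c\<in>carrier (presented_alg rels).
      embed c \<noteq> 0 \<and> z * embed c \<in> embed ` carrier (presented_alg rels)" if z: "z \<in> S" for z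
  proof -
    \<comment> \<open>Density: the nonzero multiplier is \<open>x ^ n\<close>, the image of
      \<open>U ^ n\<close>, which brings \<open>z\<close> into \<open>C\<close>.\<close>
    obtain n where "z * x ^ n \<in> C" using S_x[OF z z] by blast
    then obtain f where f: "z * x ^ n = lift f" using C_range_lift by blast
    have Un: "lift (U ^ n) = x ^ n" by (simp add: lift_power lift_U)
    have "x ^ n \<noteq> 0" using cf_x[of n "int n"] by auto
    then show ?thesis unfolding presented_alg_def quot
      using f Un by (intro bexI[of _ "coset (U ^ n)"]) (auto simp: embed_coset intro!: image_eqI[of _ _ "coset f"])
  qed
qed (auto simp: presented_alg_def quot_carrier quot_one quot_zero quot_mult quot_add quot_smult
    embed_coset lift_1 lift_0 lift_mult lift_add lift_scal lift_S)

end

section \<open>Reduction to the Weyl algebra and quantum planes\<close>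

text \<open>The set \<open>S\<close> is built from \<open>s\<close> and \<open>s'\<close> alone, so
  both algebras are dense in the same Ore domain even if \<open>a\<close> and \<open>a'\<close>
  differ.\<close>

lemma gwa_presentation_Frac_isomorphic:
  assumes "gwa_presentation s s' \<theta> rels H U V a" "gwa_presentation s s' \<theta>' rels' H' U' V' a'"
  shows "Frac (presented_alg rels) \<simeq>\<^sub>a Frac (presented_alg rels')"
proof -
  interpret A: gwa_presentation s s' \<theta> rels H U V a by fact
  interpret B: gwa_presentation s s' \<theta>' rels' H' U' V' a' by fact
  interpret frac_embedding2 A.S "presented_alg rels" "presented_alg rels'" scal_opr A.embed B.embed ..
  show ?thesis by (rule Frac_isomorphic)
qed

lemma alg_iso_poly_algD:
  assumes "\<sigma> \<in> alg_iso poly_alg poly_alg"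
  shows "bij \<sigma>" "\<sigma> p = pcompose p (\<sigma> [:0, 1:])"
proof -
  show "bij \<sigma>"
    using assms by (simp add: alg_iso_def ring_iso_def poly_alg_def type_alg_def)
  have add: "\<sigma> (p + q) = \<sigma> p + \<sigma> q" and mult: "\<sigma> (p * q) = \<sigma> p * \<sigma> q"
    and one: "\<sigma> 1 = 1" and const: "\<sigma> ([:c:] * p) = [:c:] * \<sigma> p" for p q c
    using assms by (simp_all add: alg_iso_def ring_iso_def ring_hom_def poly_alg_def type_alg_def)
  show "\<sigma> p = pcompose p (\<sigma> [:0, 1:])"
  proof (induct p)
    case 0
    show ?case using const[of 0 0] by simp
  next
    case (pCons c p)
    have c: "\<sigma> [:c:] = [:c:]" using const[of c 1] one by simp
    have "\<sigma> (pCons c p) = \<sigma> ([:c:] + [:0, 1:] * p)" by simp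
    also have "\<dots> = [:c:] + \<sigma> [:0, 1:] * \<sigma> p" by (simp only: add mult c)
    finally show ?case using pCons by (simp add: pcompose_pCons)
  qed
qed

context skew_laurent
begin

lemma free_homI:
  assumes "\<And>c g. scal_opr c * \<theta> g = \<theta> g * scal_opr c"
  shows "free_hom scal_opr \<theta>"
  by (rule free_hom.intro) (simp_all only: scal_opr_hom assms)

lemma scal_opr_commute_mult: "scal_opr c * (mulop p * y) = mulop p * y * scal_opr c"
proof -
  have "scal_opr c * (mulop p * y) = mulop p * (scal_opr c * y)"
    by (simp only: scal_opr_commute(1) mult.assoc[symmetric])
  then show ?thesis by (simp only: scal_opr_commute(3) mult.assoc)
qed

lemma x_mulop_y: "x * (mulop p * y) = mulop (pcompose p s)"
proof -
  have "x * (mulop p * y) = mulop (pcompose p s) * (x * y)"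
    by (simp only: x_mulop mult.assoc[symmetric])
  then show ?thesis by (simp add: xy)
qed

lemma gwa_is_presentation:
  assumes a: "a \<noteq> 0" and \<sigma>: "bij \<sigma>" "\<And>p. \<sigma> p = pcompose p s"
  shows "gwa_presentation s s' (case_gwa_gen (mulop [:0, 1:]) x (mulop a * y))
    ({gen Xplus * at_H d - at_H (\<sigma> d) * gen Xplus | d. True} \<union>
      {gen Xminus * at_H d - at_H (inv_into UNIV \<sigma> d) * gen Xminus | d. True} \<union>
      {gen Xminus * gen Xplus - at_H a, gen Xplus * gen Xminus - at_H (\<sigma> a)})
    (gen Hgen) (gen Xplus) (gen Xminus) a"
    (is "gwa_presentation s s' ?\<theta> ?rels _ _ _ a")
proof -
  have inv: "inv_into UNIV \<sigma> d = pcompose d s'" for d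
    by (rule inv_f_eq[OF bij_is_inj[OF \<sigma>(1)]]) (simp add: \<sigma>)
  have inv': "inv_into UNIV \<sigma> (\<sigma> d) = d" for d
    using \<sigma>(1) by (simp add: bij_is_inj)
  interpret free_hom scal_opr ?\<theta>
    by (rule free_homI) (simp add: scal_opr_commute scal_opr_commute_mult split: gwa_gen.split)
  have ev: "lift (ev (gen Hgen) p) = mulop p" for p
    by (rule lift_ev) (simp_all add: lift_gen scal_opr_def mulop_add mulop_mult)
  have comm: "mulop p * mulop q = mulop q * mulop p" for p q :: "'k poly"
    by (metis mulop_mult mult.commute)
  show ?thesis
  proof (unfold_locales)
    fix r assume "r \<in> ?rels"
    then consider d where "r = gen Xplus * at_H d - at_H (\<sigma> d) * gen Xplus"
      | d where "r = gen Xminus * at_H d - at_H (inv_into UNIV \<sigma> d) * gen Xminus"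
      | "r = gen Xminus * gen Xplus - at_H a" | "r = gen Xplus * gen Xminus - at_H (\<sigma> a)"
      by auto
    then show "lift r = 0"
    proof cases
      case 1
      then show ?thesis by (simp add: at_H_ev lift_diff lift_mult ev lift_gen \<sigma> x_mulop)
    next
      case 2
      have "mulop a * y * mulop d = mulop (pcompose d s') * (mulop a * y)"
        by (simp only: mult.assoc y_mulop) (simp only: mult.assoc[symmetric] comm)
      then show ?thesis using 2 by (simp add: at_H_ev lift_diff lift_mult ev lift_gen inv)
    next
      case 3
      then show ?thesis by (simp add: at_H_ev lift_diff lift_mult ev lift_gen yx mult.assoc)
    next
      case 4
      have "x * (mulop a * y) = mulop (pcompose a s)"
        by (rule x_mulop_y)
      then show ?thesis using 4 by (simp add: at_H_ev lift_diff lift_mult ev lift_gen \<sigma>)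
    qed
  next
    have mem: "r \<in> Idl\<^bsub>free_alg\<^esub> ?rels" if "r \<in> ?rels" for r
      using ring.genideal_self[OF ring_free_alg, of ?rels] that by auto
    show "gen Xplus * ev (gen Hgen) d - ev (gen Hgen) (pcompose d s) * gen Xplus \<in> Idl\<^bsub>free_alg\<^esub> ?rels" for d
      by (rule mem) (auto simp: at_H_ev \<sigma>)
    \<comment> \<open>The defining relation involves the inverse of \<sigma>; taken at
      \<open>\<sigma> d\<close> it has the form required here.\<close>
    show "gen Xminus * ev (gen Hgen) (pcompose d s) - ev (gen Hgen) d * gen Xminus \<in> Idl\<^bsub>free_alg\<^esub> ?rels" for d
      unfolding at_H_ev[symmetric] \<sigma>(2)[symmetric]
      by (rule mem, rule UnI1, rule UnI2, rule CollectI, rule exI[of _ "\<sigma> d"]) (simp add: inv')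
    show "gen Xminus * gen Xplus - ev (gen Hgen) a \<in> Idl\<^bsub>free_alg\<^esub> ?rels"
      by (rule mem) (simp add: at_H_ev)
    show "gen Xplus * gen Xminus - ev (gen Hgen) (pcompose a s) \<in> Idl\<^bsub>free_alg\<^esub> ?rels"
      by (rule mem) (simp add: at_H_ev \<sigma>)
    show "gen g \<in> {gen Hgen, gen Xplus, gen Xminus}" for g
      by (cases g) simp_all
  qed (simp_all add: a lift_gen)
qed

text \<open>A nonconstant affine polynomial generates \<open>k[h]\<close> as well as
  \<open>h\<close> does; commutation is directly available only for \<open>y x\<close>, which is
  affine in \<open>h\<close>.\<close>

lemma poly_affine_induct:
  assumes const: "\<And>c. P [:c:]" and add: "\<And>p q. P p \<Longrightarrow> P q \<Longrightarrow> P (p + q)"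
    and mult: "\<And>p q. P p \<Longrightarrow> P q \<Longrightarrow> P (p * q)" and affine: "P [:\<delta>, \<gamma>:]" "\<gamma> \<noteq> 0"
  shows "P (d :: 'k poly)"
proof (induct d)
  case 0
  show ?case using const[of 0] by simp
next
  case (pCons c d)
  have "[:0, 1:] = [:1 / \<gamma>:] * [:\<delta>, \<gamma>:] + [:- \<delta> / \<gamma>:]"
    using affine by simp
  then have "P [:0, 1:]" using const add mult affine by metis
  then have "P ([:c:] + [:0, 1:] * d)" using const add mult pCons by metis
  then show ?case by simp
qed

text \<open>An algebra with the relation \<open>x y = \<alpha> y x + \<beta>\<close> is a generalized Weyl algebra with \<open>y x\<close> an
  affine function \<open>\<gamma> h + \<delta>\<close> of \<open>h\<close>; the coefficients are chosen such that the automorphism becomes the given one.\<close>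

lemma xy_is_presentation:
  fixes rels :: "(xy_gen word \<Rightarrow>\<^sub>0 'k) set" and \<delta> \<gamma> :: 'k
  defines "\<theta> \<equiv> case_xy_gen x (mulop [:\<delta>, \<gamma>:] * y)"
  assumes \<gamma>: "\<gamma> \<noteq> 0" and s: "pcompose [:\<delta>, \<gamma>:] s = [:\<alpha>:] * [:\<delta>, \<gamma>:] + [:\<beta>:]"
    and lift_rels: "\<And>r. r \<in> rels \<Longrightarrow> free_hom.lift scal_opr \<theta> r = 0"
    and comm: "gen Xgen * gen Ygen - (scal \<alpha> * (gen Ygen * gen Xgen) + scal \<beta>) \<in> Idl\<^bsub>free_alg\<^esub> rels"
  shows "gwa_presentation s s' \<theta> rels
    (scal (1 / \<gamma>) * (gen Ygen * gen Xgen) + scal (- \<delta> / \<gamma>)) (gen Xgen) (gen Ygen) [:\<delta>, \<gamma>:]"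
    (is "gwa_presentation _ _ _ _ ?H _ _ ?a")
proof -
  interpret free_hom scal_opr \<theta>
    by (rule free_homI) (simp add: \<theta>_def scal_opr_commute scal_opr_commute_mult split: xy_gen.split)
  interpret free_ideal "Idl\<^bsub>free_alg\<^esub> rels"
    by (rule free_ideal.intro, rule ring.genideal_ideal[OF ring_free_alg]) simp
  let ?U = "gen Xgen :: xy_gen word \<Rightarrow>\<^sub>0 'k" and ?V = "gen Ygen :: xy_gen word \<Rightarrow>\<^sub>0 'k"
  \<comment> \<open>\<open>?H\<close> is solved from \<open>\<gamma> H + \<delta> = y x\<close>, so
    this holds already in the free algebra.\<close>
  have ev_a: "ev ?H ?a = ?V * ?U"
  proof -
    have "ev ?H ?a = scal \<delta> + ?H * scal \<gamma>" by (simp add: ev_pCons)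
    also have "\<dots> = scal \<delta> + scal \<gamma> * ?H" by (simp only: scal_commute)
    also have "\<dots> = scal (\<delta> + \<gamma> * (- \<delta> / \<gamma>)) + scal (\<gamma> * (1 / \<gamma>)) * (?V * ?U)"
      by (simp only: scal_mult scal_add distrib_left mult.assoc add_ac)
    also have "\<dots> = ?V * ?U" using \<gamma> by simp
    finally show ?thesis .
  qed
  have ev_sa: "cong (?U * ?V) (ev ?H (pcompose ?a s))"
    using comm unfolding s ev_add ev_mult ev_a ev_const cong_def .
  have const: "cong (scal c * f) (f * scal c)" for c f
    by (simp add: scal_commute cong_refl)
  have lift_U: "lift ?U = x" and lift_V: "lift ?V = mulop ?a * y"
    unfolding lift_gen by (simp_all add: \<theta>_def)
  have lift_H: "lift ?H = mulop [:0, 1:]"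
  proof -
    have "lift ?H = scal_opr (1 / \<gamma>) * (mulop ?a * (y * x)) + scal_opr (- \<delta> / \<gamma>)"
      by (simp add: lift_add lift_mult lift_scal lift_U lift_V mult.assoc)
    also have "\<dots> = mulop ([:1 / \<gamma>:] * ?a + [:- \<delta> / \<gamma>:])"
      unfolding yx mult_1_right scal_opr_def mulop_add mulop_mult ..
    also have "[:1 / \<gamma>:] * ?a + [:- \<delta> / \<gamma>:] = [:0, 1:]" using \<gamma> by simp
    finally show ?thesis .
  qed
  have U_ev: "cong (?U * ev ?H d) (ev ?H (pcompose d s) * ?U)" for d
  proof (induct d rule: poly_affine_induct[where \<delta> = \<delta> and \<gamma> = \<gamma>])
    case (1 c)
    show ?case using cong_sym[OF const] by (simp add: ev_const)
  next
    case (2 p q)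
    show ?case using cong_add[OF 2] by (simp add: pcompose_add ev_add distrib_left distrib_right)
  next
    case (3 p q)
    have "cong (?U * ev ?H p * ev ?H q) (ev ?H (pcompose p s) * ?U * ev ?H q)"
      by (rule cong_right[OF 3(1)])
    also have "\<dots> = ev ?H (pcompose p s) * (?U * ev ?H q)" by (simp only: mult.assoc)
    also have "cong \<dots> (ev ?H (pcompose p s) * (ev ?H (pcompose q s) * ?U))"
      by (rule cong_left[OF 3(2)])
    finally show ?case by (simp only: pcompose_mult ev_mult mult.assoc)
  next
    case 4
    \<comment> \<open>Associativity: \<open>U (V U) = (U V) U\<close>, and \<open>U V\<close> is
      congruent to \<open>\<sigma>(a)\<close> at \<open>H\<close>.\<close>
    show ?case using cong_right[OF ev_sa, of ?U] by (simp only: ev_a mult.assoc)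
  qed (rule \<gamma>)
  have V_ev: "cong (?V * ev ?H (pcompose d s)) (ev ?H d * ?V)" for d
  proof (induct d rule: poly_affine_induct[where \<delta> = \<delta> and \<gamma> = \<gamma>])
    case (1 c)
    show ?case using cong_sym[OF const] by (simp add: ev_const)
  next
    case (2 p q)
    show ?case using cong_add[OF 2] by (simp add: pcompose_add ev_add distrib_left distrib_right)
  next
    case (3 p q)
    have "cong (?V * ev ?H (pcompose p s) * ev ?H (pcompose q s)) (ev ?H p * ?V * ev ?H (pcompose q s))"
      by (rule cong_right[OF 3(1)])
    also have "\<dots> = ev ?H p * (?V * ev ?H (pcompose q s))" by (simp only: mult.assoc)
    also have "cong \<dots> (ev ?H p * (ev ?H q * ?V))"
      by (rule cong_left[OF 3(2)])
    finally show ?case by (simp only: pcompose_mult ev_mult mult.assoc)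
  next
    case 4
    \<comment> \<open>Again associativity, now as \<open>V (U V) = (V U) V\<close>.\<close>
    show ?case using cong_sym[OF cong_left[OF ev_sa, of ?V]] by (simp only: ev_a mult.assoc)
  qed (rule \<gamma>)
  show ?thesis
  proof (unfold_locales)
    show "gen g \<in> {?H, ?U, ?V}" for g by (cases g) simp_all
    show "?V * ?U - ev ?H ?a \<in> Idl\<^bsub>free_alg\<^esub> rels" unfolding ev_a using I_0 by simp
  qed (use \<gamma> lift_rels lift_H lift_U lift_V ev_sa U_ev V_ev in \<open>simp_all add: cong_def\<close>)
qed

lemma Frac_presented_weyl:
  assumes "gwa_presentation s s' \<theta> rels H U V a" and s: "s = [:\<beta>, 1:]" "\<beta> \<noteq> 0"
  shows "Frac (presented_alg rels) \<simeq>\<^sub>a Frac (weyl_alg :: ('k, _) module)"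
proof -
  \<comment> \<open>With \<open>a = b h\<close> one has \<open>\<sigma>(a) = a + b \<beta>\<close>;
    the choice \<open>b \<beta> = -1\<close> gives \<open>x y = y x - 1\<close>.\<close>
  define b where "b = - 1 / \<beta>"
  have b: "b \<noteq> 0" "b * \<beta> = - 1" using s by (simp_all add: b_def)
  let ?\<theta> = "case_xy_gen x (mulop [:0, b:] * y)"
  let ?r = "gen Ygen * gen Xgen - gen Xgen * gen Ygen - 1 :: xy_gen word \<Rightarrow>\<^sub>0 'k"
  interpret free_hom scal_opr ?\<theta>
    by (rule free_homI) (simp add: scal_opr_commute scal_opr_commute_mult split: xy_gen.split)
  have aff: "pcompose [:0, b:] s = [:1:] * [:0, b:] + [:- 1:]"
    using s b by (simp add: pcompose_pCons mult.commute)
  have "x * (mulop [:0, b:] * y) = mulop (pcompose [:0, b:] s)"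
    by (rule x_mulop_y)
  then have xv: "x * (mulop [:0, b:] * y) = mulop [:0, b:] - 1"
    unfolding aff using mulop_diff[of "[:0, b:]" 1] mulop_1[unfolded one_pCons] by (simp add: one_pCons)
  have "lift ?r = 0"
    by (simp add: lift_diff lift_mult lift_gen lift_1 xv yx mult.assoc)
  moreover have "gen Xgen * gen Ygen - (scal 1 * (gen Ygen * gen Xgen) + scal (- 1)) \<in> Idl\<^bsub>free_alg\<^esub> {?r}"
  proof -
    interpret free_ideal "Idl\<^bsub>free_alg\<^esub> {?r}"
      by (rule free_ideal.intro, rule ring.genideal_ideal[OF ring_free_alg]) simp
    have "- ?r \<in> Idl\<^bsub>free_alg\<^esub> {?r}"
      by (rule I_minus, rule ring.genideal_self'[OF ring_free_alg]) simp
    moreover have "scal (- 1) = (- 1 :: xy_gen word \<Rightarrow>\<^sub>0 'k)"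
      using scal_add[of 1 "- 1"] by (simp add: eq_neg_iff_add_eq_0 add.commute)
    ultimately show ?thesis by (simp add: algebra_simps)
  qed
  ultimately have "gwa_presentation s s' ?\<theta> {?r}
    (scal (1 / b) * (gen Ygen * gen Xgen) + scal (- 0 / b)) (gen Xgen) (gen Ygen) [:0, b:]"
    using b by (intro xy_is_presentation[OF _ aff]) simp_all
  then show ?thesis unfolding weyl_alg_def
    by (rule gwa_presentation_Frac_isomorphic[OF assms(1)])
qed

text \<open>On \<open>h + \<delta>\<close> the automorphism is multiplication by
  \<open>\<alpha>\<close>, so \<open>x y = \<alpha> y x\<close>; as the quantum plane is written
  \<open>y x = q x y\<close>, the parameter is the inverse of \<open>\<alpha>\<close>.\<close>

lemma Frac_presented_quantum_plane:
  assumes "gwa_presentation s s' \<theta> rels H U V a" and s: "s = [:\<beta>, \<alpha>:]" "\<alpha> \<noteq> 0" "\<alpha> = 1 \<longrightarrow> \<beta> = 0"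
  shows "Frac (presented_alg rels) \<simeq>\<^sub>a Frac (quantum_plane (1 / \<alpha>))"
proof -
  \<comment> \<open>Fixed by requiring \<open>h + \<delta>\<close> to be an eigenvector of \<sigma>:
    \<open>\<beta> + \<delta> = \<alpha> \<delta>\<close>. If \<open>\<alpha> = 1\<close>, then
    \<sigma> is the identity and every \<open>\<delta>\<close> qualifies, in particular the value
    \<open>0\<close> of the division by zero.\<close>
  define \<delta> where "\<delta> = - \<beta> / (1 - \<alpha>)"
  let ?\<theta> = "case_xy_gen x (mulop [:\<delta>, 1:] * y)"
  let ?r = "gen Ygen * gen Xgen - scal (1 / \<alpha>) * gen Xgen * gen Ygen :: xy_gen word \<Rightarrow>\<^sub>0 'k"
  interpret free_hom scal_opr ?\<theta>
    by (rule free_homI) (simp add: scal_opr_commute scal_opr_commute_mult split: xy_gen.split)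
  have aff: "pcompose [:\<delta>, 1:] s = [:\<alpha>:] * [:\<delta>, 1:] + [:0:]"
  proof (cases "\<alpha> = 1")
    case True
    then show ?thesis using s by (simp add: pcompose_pCons)
  next
    case False
    then show ?thesis using s by (simp add: pcompose_pCons \<delta>_def field_simps)
  qed
  have "x * (mulop [:\<delta>, 1:] * y) = mulop (pcompose [:\<delta>, 1:] s)"
    by (rule x_mulop_y)
  then have xv: "x * (mulop [:\<delta>, 1:] * y) = scal_opr \<alpha> * mulop [:\<delta>, 1:]"
    unfolding aff mulop_add mulop_mult scal_opr_def by simp
  have "scal_opr (1 / \<alpha>) * (scal_opr \<alpha> * z) = z" for z :: "'k opr"
    using s by (simp add: scal_opr_hom(2) flip: mult.assoc scal_opr_hom(4))
  then have "lift ?r = 0"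
    by (simp add: lift_diff lift_mult lift_gen lift_scal xv yx mult.assoc)
  moreover have "gen Xgen * gen Ygen - (scal \<alpha> * (gen Ygen * gen Xgen) + scal 0) \<in> Idl\<^bsub>free_alg\<^esub> {?r}"
  proof -
    interpret free_ideal "Idl\<^bsub>free_alg\<^esub> {?r}"
      by (rule free_ideal.intro, rule ring.genideal_ideal[OF ring_free_alg]) simp
    have "- scal \<alpha> * ?r \<in> Idl\<^bsub>free_alg\<^esub> {?r}"
      by (rule I_left, rule ring.genideal_self'[OF ring_free_alg]) simp
    moreover have "scal \<alpha> * (scal (1 / \<alpha>) * f) = f" for f :: "xy_gen word \<Rightarrow>\<^sub>0 'k"
      using s by (simp flip: mult.assoc scal_mult)
    ultimately show ?thesis by (simp add: algebra_simps)
  qed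
  ultimately have "gwa_presentation s s' ?\<theta> {?r}
    (scal (1 / 1) * (gen Ygen * gen Xgen) + scal (- \<delta> / 1)) (gen Xgen) (gen Ygen) [:\<delta>, 1:]"
    by (intro xy_is_presentation[OF _ aff]) simp_all
  then show ?thesis unfolding quantum_plane_def
    by (rule gwa_presentation_Frac_isomorphic[OF assms(1)])
qed

end

theorem corollary6p15:
  fixes a :: "'k::{alg_closed_field, field_char_0} poly"
    and \<sigma> :: "'k poly \<Rightarrow> 'k poly"
  assumes "a \<noteq> 0"
    and "\<sigma> \<in> alg_iso poly_alg poly_alg"
  shows "Frac (gwa a \<sigma>) \<simeq>\<^sub>a Frac (weyl_alg :: ('k, _) module)
       \<or> (\<exists>q::'k. q \<noteq> 0 \<and> Frac (gwa a \<sigma>) \<simeq>\<^sub>a Frac (quantum_plane q))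
       \<or> Frac (gwa a \<sigma>) \<simeq>\<^sub>a (ratfun2_alg :: ('k, _) module)"
proof -
  define s where "s = \<sigma> [:0, 1:]"
  have bij: "bij \<sigma>" and \<sigma>: "\<sigma> p = pcompose p s" for p
    unfolding s_def by (rule alg_iso_poly_algD[OF assms(2)])+
  obtain s' where s': "\<sigma> s' = [:0, 1:]" using bij by (metis bij_pointE)
  \<comment> \<open>The choice of \<open>s'\<close> gives one inverse law; \<sigma> sends both
    \<open>pcompose s s'\<close> and \<open>h\<close> to \<open>s\<close>, so injectivity gives the
    other.\<close>
  have "\<sigma> (pcompose s s') = pcompose s (\<sigma> s')" by (simp add: \<sigma> pcompose_assoc)
  then have "\<sigma> (pcompose s s') = \<sigma> [:0, 1:]" by (simp add: s' s_def)
  then have ss': "pcompose s s' = [:0, 1:]" using bij by (simp add: bij_def inj_eq)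
  interpret skew_laurent s s' by standard (use ss' s' \<sigma> in auto)
  \<comment> \<open>Degrees multiply under composition, so a substitution with an inverse has degree
    one.\<close>
  have "degree s * degree s' = degree (pcompose s s')" by (rule degree_pcompose[symmetric])
  then have "degree s * degree s' = 1" unfolding ss' by simp
  then have "degree s = 1" by simp
  then obtain \<beta> \<alpha> where s: "s = [:\<beta>, \<alpha>:]" "\<alpha> \<noteq> 0"
    using degree1_coeffs by blast
  note pres = gwa_is_presentation[OF assms(1) bij \<sigma>]
  show ?thesis
  proof (cases "\<alpha> = 1 \<and> \<beta> \<noteq> 0")
    case True
    then have "Frac (gwa a \<sigma>) \<simeq>\<^sub>a Frac (weyl_alg :: ('k, _) module)"
      unfolding gwa_def using Frac_presented_weyl[OF pres] s by simp
    then show ?thesis ..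
  next
    case False
    then have "Frac (gwa a \<sigma>) \<simeq>\<^sub>a Frac (quantum_plane (1 / \<alpha>))"
      unfolding gwa_def using Frac_presented_quantum_plane[OF pres s] by blast
    moreover have "1 / \<alpha> \<noteq> 0" using s by simp
    ultimately show ?thesis by blast
  qed
qed

end
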